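(* Let $X$ be a real Banach space. Suppose that at least one of the following three conditions holds: (i) every dual ball in $X^{**}$ is weak$^*$-separable; (ii) every weak$^*$-closed convex subset of $X^{**}$ is weak$^*$-separable; (iii) every norm-closed convex subset of $X^{*}$ is constructible. Then $X$ admits an equivalent norm that is Fréchet differentiable at every $x\in X$ with $x\neq 0$.
   Context: All Banach spaces are real and nonzero. The weak$^*$ topology on $X^{**}$ is the topology $\sigma(X^{**},X^{*})$. A subset of $X^{**}$ is weak$^*$-separable if it has a countable subset that is dense in it for the relative weak$^*$ topology. A dual ball in $X^{**}$ is the closed unit ball of a norm on $X^{**}$ which is the dual norm of some equivalent norm on $X^{*}$. A closed half-space of a Banach space $Y$ is a set $f^{-1}(-\infty,\alpha]$ with $f\in Y^{*}\setminus\{0\}$ and $\alpha\in\mathbb{R}$. A closed convex set $C\subset Y$ is constructible if it is a countable intersection of closed half-spaces of $Y$; the empty intersection is allowed and equals $Y$. In (iii) this is applied with $Y=X^{*}$, so the functionals range over $X^{**}\setminus\{0\}$. A norm $\|\cdot\|$ on $X$ is Fréchet differentiable at $x\neq 0$ if there is $x^{*}\in X^{*}$ such that $\lim_{t\to 0}\frac{\|x+ty\|-\|x\|}{t}=\langle x^{*},y\rangle$ uniformly over $y$ in the unit sphere of $X$. *)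

theory Defs
  imports "HOL-Analysis.Analysis"
begin

type_synonym 'a dual = "'a \<Rightarrow>\<^sub>L real"

definition is_norm :: "('b::real_vector \<Rightarrow> real) \<Rightarrow> bool" where
  "is_norm p \<longleftrightarrow>
     (\<forall>x. 0 \<le> p x) \<and> (\<forall>x. p x = 0 \<longleftrightarrow> x = 0) \<and>
     (\<forall>a x. p (a *\<^sub>R x) = \<bar>a\<bar> * p x) \<and> (\<forall>x y. p (x + y) \<le> p x + p y)"

definition equivalent_norm :: "('b::real_normed_vector \<Rightarrow> real) \<Rightarrow> bool" where
  "equivalent_norm p \<longleftrightarrow>
     is_norm p \<and> (\<exists>c>0. \<exists>C>0. \<forall>x. c * norm x \<le> p x \<and> p x \<le> C * norm x)"

text \<open>The supremum is over a nonempty set, which is bounded when \<open>q\<close> is an equivalent norm.\<close>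

definition dual_norm :: "('b::real_normed_vector \<Rightarrow> real) \<Rightarrow> 'b dual \<Rightarrow> real" where
  "dual_norm q F = (SUP f\<in>{f. q f \<le> 1}. \<bar>blinfun_apply F f\<bar>)"

definition dual_ball :: "'b::real_normed_vector dual set \<Rightarrow> bool" where
  "dual_ball B \<longleftrightarrow> (\<exists>q. equivalent_norm q \<and> B = {F. dual_norm q F \<le> 1})"

text \<open>For scalar-valued operators the strong operator topology, i.e. the topology of pointwise
  convergence, is the weak-star topology of the dual.\<close>

abbreviation weak_star :: "'b::real_normed_vector dual topology" where
  "weak_star \<equiv> strong_operator_topology"

definition weak_star_separable :: "'b::real_normed_vector dual set \<Rightarrow> bool" where
  "weak_star_separable S \<longleftrightarrow>
     (\<exists>D. countable D \<and> D \<subseteq> S \<and> subtopology weak_star S closure_of D = S)"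

definition closed_half_space :: "'b::real_normed_vector set \<Rightarrow> bool" where
  "closed_half_space H \<longleftrightarrow>
     (\<exists>(f::'b dual) \<alpha>. f \<noteq> 0 \<and> H = {y. blinfun_apply f y \<le> \<alpha>})"

definition constructible :: "'b::real_normed_vector set \<Rightarrow> bool" where
  "constructible C \<longleftrightarrow> closed C \<and> convex C \<and>
     (\<exists>\<H>. countable \<H> \<and> (\<forall>H\<in>\<H>. closed_half_space H) \<and> C = \<Inter>\<H>)"

text \<open>The unit sphere is that of \<open>p\<close> itself.\<close>

definition frechet_differentiable_norm_at ::
    "('a::real_normed_vector \<Rightarrow> real) \<Rightarrow> 'a \<Rightarrow> bool" where
  "frechet_differentiable_norm_at p x \<longleftrightarrow>
     (\<exists>x'::'a dual. uniform_limit {y. p y = 1}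
        (\<lambda>t y. (p (x + t *\<^sub>R y) - p x) / t) (blinfun_apply x') (at 0))"

end

theory Submission
  imports Defs
begin

text \<open>
  Each of the three conditions forces \<open>X\<^sup>*\<close> to be separable, and a space with separable dual has an
  equivalent Frechet differentiable norm.

  For the first part, suppose that \<open>X\<^sup>*\<close> contains an uncountable bounded set \<open>P\<close> with uniformly
  bounded functionals \<open>\<Phi>\<^sub>p\<close> such that \<open>\<Phi>\<^sub>p p = 1\<close> and \<open>\<bar>\<Phi>\<^sub>p q\<bar> \<le> 1/2\<close> for \<open>q \<noteq> p\<close>.  Then some equivalent
  unit ball of \<open>X\<^sup>*\<close> contains all midpoints of distinct points of \<open>P\<close> but no point of \<open>P\<close>.  A half-space
  containing this ball therefore excludes at most one point of \<open>P\<close>, so countably many of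
  them do not cut out the ball; equivalently, its polar is not weak-star separable.  Such a \<open>P\<close> exists
  whenever \<open>X\<^sup>*\<close> is nonseparable.  If \<open>X\<close> is nonseparable, choose by transfinite recursion \<open>f\<^sub>\<alpha>\<close> of norm
  one that vanishes on a countable set norming the span of the earlier \<open>f\<^sub>\<beta>\<close>; then \<open>f\<^sub>\<alpha>\<close> has distance at least
  \<open>1/2\<close> from the span of all the others.  If \<open>X\<close> is separable, a dyadic tree of large subsets
  of \<open>X\<^sup>*\<close> as in Stegall's theorem gives \<open>P\<close> indexed by the branches.

  For the second part, let \<open>(h\<^sub>k)\<close> be dense in \<open>X\<^sup>*\<close> and let \<open>B\<close> be a sublevel set of
  \<open>\<Sum>\<^sub>k c\<^sub>k (\<parallel>f - h\<^sub>k\<parallel>\<^sup>2 + \<parallel>f + h\<^sub>k\<parallel>\<^sup>2)\<close>.  The new norm is the support function of \<open>B\<close>.  Any maximizer over \<open>B\<close> of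
  the evaluation at a point is strongly exposed: along a maximizing sequence \<open>(f\<^sub>n)\<close> the convexity gaps
  tend to zero, hence \<open>\<parallel>f\<^sub>n - h\<^sub>k\<parallel> \<rightarrow> \<parallel>f - h\<^sub>k\<parallel>\<close> for every \<open>k\<close>, and choosing \<open>h\<^sub>k\<close> near \<open>f\<close> gives norm convergence.
\<close>

section \<open>Hahn-Banach theorems and weak-star compactness\<close>

definition sublinear :: "('a::real_vector \<Rightarrow> real) \<Rightarrow> bool" where
  "sublinear p \<longleftrightarrow> (\<forall>x y. p (x + y) \<le> p x + p y) \<and> (\<forall>c x. 0 \<le> c \<longrightarrow> p (c *\<^sub>R x) = c * p x)"

lemma sublinearD:
  assumes "sublinear p"
  shows "p (x + y) \<le> p x + p y" and "0 \<le> c \<Longrightarrow> p (c *\<^sub>R x) = c * p x" and "p 0 = 0" and "- p (- x) \<le> p x"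
proof -
  show *: "p (x + y) \<le> p x + p y" for x y using assms by (auto simp: sublinear_def)
  show **: "0 \<le> c \<Longrightarrow> p (c *\<^sub>R x) = c * p x" for c x using assms by (auto simp: sublinear_def)
  show ***: "p 0 = 0" using **[of 0 0] by simp
  show "- p (- x) \<le> p x" using *[of x "-x"] *** by simp
qed

text \<open>The bound for the inverse scalar yields the reverse inequality, so one direction for
  positive scalars is enough.\<close>

lemma sublinearI:
  assumes "\<And>x y. p (x + y) \<le> p x + p y" and "p 0 = 0"
    and le: "\<And>c x. 0 < c \<Longrightarrow> p (c *\<^sub>R x) \<le> c * p x"
  shows "sublinear p"
  unfolding sublinear_def
proof (intro conjI allI impI)
  fix c :: real and x assume "0 \<le> c"
  show "p (c *\<^sub>R x) = c * p x"
  proof (cases "c = 0")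
    case False
    then have c: "c > 0" using \<open>0 \<le> c\<close> by simp
    have "p (inverse c *\<^sub>R (c *\<^sub>R x)) \<le> inverse c * p (c *\<^sub>R x)" by (rule le) (use c in simp)
    then have "c * p x \<le> p (c *\<^sub>R x)" using c by (simp add: field_simps)
    then show ?thesis using le[OF c, of x] by simp
  qed (use assms in simp)
qed (use assms in blast)

text \<open>The witness is the infimal convolution
  \<open>q x = (INF s\<in>S. p (x + s) - f s)\<close>, finite because \<open>f \<le> p\<close> on
  \<open>S\<close>. Every linear minorant \<open>g\<close> of \<open>q\<close> satisfies
  \<open>f \<le> g\<close> on \<open>S\<close>. Asking only for a convex cone \<open>S\<close>
  admits rays as well as subspaces; the last clause records that \<open>q x\<close> is a greatest
  lower bound.\<close>

lemma sublinear_inf_correction: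
  fixes p :: "'a::real_vector \<Rightarrow> real"
  assumes p: "sublinear p" and S0: "0 \<in> S"
    and Sadd: "\<And>x y. x \<in> S \<Longrightarrow> y \<in> S \<Longrightarrow> x + y \<in> S"
    and Sscale: "\<And>c x. 0 \<le> c \<Longrightarrow> x \<in> S \<Longrightarrow> c *\<^sub>R x \<in> S"
    and fadd: "\<And>x y. x \<in> S \<Longrightarrow> y \<in> S \<Longrightarrow> f (x + y) = f x + f y"
    and fscale: "\<And>c x. 0 \<le> c \<Longrightarrow> x \<in> S \<Longrightarrow> f (c *\<^sub>R x) = c * f x"
    and fle: "\<And>x. x \<in> S \<Longrightarrow> f x \<le> p x"
  obtains q where "sublinear q" and "\<And>x. q x \<le> p x" and "\<And>s. s \<in> S \<Longrightarrow> q (- s) \<le> - f s"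
    and "\<And>d x. (\<And>s. s \<in> S \<Longrightarrow> d \<le> p (x + s) - f s) \<Longrightarrow> d \<le> q x"
proof -
  define q where "q = (\<lambda>x. INF s\<in>S. p (x + s) - f s)"
  note pD = sublinearD[OF p]
  have f0: "f 0 = 0" using fscale[of 0 0] S0 by simp
  have bdd: "bdd_below ((\<lambda>s. p (x + s) - f s) ` S)" for x
  proof (rule bdd_belowI2)
    fix s assume "s \<in> S"
    then show "- p (- x) \<le> p (x + s) - f s"
      using fle[of s] pD(1)[of "x + s" "- x"] by simp
  qed
  have up: "q x \<le> p (x + s) - f s" if "s \<in> S" for x s
    unfolding q_def by (rule cINF_lower[OF bdd that])
  have low: "d \<le> q x" if "\<And>s. s \<in> S \<Longrightarrow> d \<le> p (x + s) - f s" for d x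
    unfolding q_def by (rule cINF_greatest) (use S0 that in auto)
  have qp: "q x \<le> p x" for x using up[OF S0, of x] f0 by simp
  have qneg: "q (- s) \<le> - f s" if "s \<in> S" for s using up[OF that, of "- s"] pD(3) by simp
  have "sublinear q"
  proof (rule sublinearI)
    fix x y
    have *: "q (x + y) - (p (y + t) - f t) \<le> p (x + s) - f s" if "s \<in> S" "t \<in> S" for s t
      using up[OF Sadd[OF that], of "x + y"] pD(1)[of "x + s" "y + t"] fadd[OF that]
      by (simp add: algebra_simps)
    then have "q (x + y) - (p (y + t) - f t) \<le> q x" if "t \<in> S" for t using low that by blast
    then have "q (x + y) - q x \<le> p (y + t) - f t" if "t \<in> S" for t using that by force
    then have "q (x + y) - q x \<le> q y" by (rule low)
    then show "q (x + y) \<le> q x + q y" by simp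
  next
    show "q 0 = 0"
    proof (rule order.antisym)
      show "q 0 \<le> 0" using qp[of 0] pD(3) by simp
      show "0 \<le> q 0" using fle by (intro low) simp
    qed
  next
    fix c :: real and x assume c: "0 < c"
    have "q (c *\<^sub>R x) / c \<le> p (x + s) - f s" if "s \<in> S" for s
    proof -
      have "q (c *\<^sub>R x) \<le> p (c *\<^sub>R x + c *\<^sub>R s) - f (c *\<^sub>R s)" using Sscale[of c s] that c up by simp
      also have "\<dots> = c * (p (x + s) - f s)"
        using pD(2)[of c "x + s"] fscale[of c s] c that by (simp add: algebra_simps)
      finally show ?thesis using c by (simp add: field_simps)
    qed
    then have "q (c *\<^sub>R x) / c \<le> q x" by (rule low)
    then show "q (c *\<^sub>R x) \<le> c * q x" using c by (simp add: field_simps)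
  qed
  then show thesis using qp qneg low by (rule that)
qed

text \<open>Correcting \<open>q\<close> along the ray through \<open>x\<close> gives a sublinear minorant with value at most \<open>- q x\<close>
  at \<open>- x\<close>; by minimality it is \<open>q\<close> itself, so \<open>q\<close> is odd.\<close>

lemma minimal_sublinear_linear:
  fixes q :: "'a::real_vector \<Rightarrow> real"
  assumes q: "sublinear q" and min: "\<And>r. sublinear r \<Longrightarrow> (\<And>x. r x \<le> q x) \<Longrightarrow> r = q"
  shows "linear q"
proof -
  note qD = sublinearD[OF q]
  have neg: "q (- x) = - q x" for x
  proof -
    define S where "S = {t *\<^sub>R x |t. 0 \<le> t}"
    have S: "0 \<in> S" "\<And>a b. a \<in> S \<Longrightarrow> b \<in> S \<Longrightarrow> a + b \<in> S" "\<And>c a. 0 \<le> c \<Longrightarrow> a \<in> S \<Longrightarrow> c *\<^sub>R a \<in> S" "x \<in> S"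
      unfolding S_def
      by (force, clarify, metis add_nonneg_nonneg scaleR_add_left, clarsimp,
          metis mult_nonneg_nonneg scaleR_scaleR, clarsimp, metis scaleR_one zero_le_one)
    have add: "q (a + b) = q a + q b" if "a \<in> S" "b \<in> S" for a b
      using that qD(2) by (auto simp: S_def simp flip: scaleR_add_left) (simp add: algebra_simps)
    obtain r where r: "sublinear r" "\<And>x. r x \<le> q x" "\<And>s. s \<in> S \<Longrightarrow> r (- s) \<le> - q s"
      by (rule sublinear_inf_correction[where p = q and f = q and S = S, OF q S(1-3) add qD(2) order_refl]) blast+
    have "r = q" using r(1,2) by (intro min) auto
    then have "q (- x) \<le> - q x" using r(3)[OF S(4)] by simp
    then show ?thesis using qD(4)[of x] by simp
  qed
  show ?thesis
  proof (rule linearI)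
    fix x y show "q (x + y) = q x + q y"
      using qD(1)[of x y] qD(1)[of "x + y" "- y"] neg[of y] by simp
  next
    fix c :: real and x show "q (c *\<^sub>R x) = c *\<^sub>R q x"
    proof (cases "0 \<le> c")
      case False
      then have "q ((- c) *\<^sub>R x) = (- c) * q x" by (intro qD(2)) simp
      then show ?thesis using neg[of "c *\<^sub>R x"] by simp
    qed (simp add: qD(2))
  qed
qed

text \<open>Zorn's lemma gives a pointwise minimal sublinear functional below \<open>p\<close>, and
  minimality forces linearity.\<close>

lemma hahn_banach_sublinear:
  fixes p :: "'a::real_vector \<Rightarrow> real"
  assumes p: "sublinear p"
  obtains g where "linear g" and "\<And>x. g x \<le> p x"
proof -
  define A where "A = {q. sublinear q \<and> (\<forall>x. q x \<le> p x)}"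
  \<comment> \<open>The order is reversed: an upper bound for \<open>P\<close> is a pointwise lower
    bound, obtained below as an infimum over the chain.\<close>
  define P where "P = (\<lambda>q r :: 'a \<Rightarrow> real. r \<le> q)"
  have po: "partial_order_on A (relation_of P A)"
    by (auto simp: P_def relation_of_def partial_order_on_def preorder_on_def refl_on_def trans_def antisym_def)
  have "\<exists>u \<in> A. \<forall>a \<in> C. P a u" if C: "C \<in> Chains (relation_of P A)" for C
  proof (cases "C = {}")
    case True
    then show ?thesis using p by (auto simp: A_def)
  next
    case False
    have CA: "q \<in> A" if "q \<in> C" for q using that C unfolding Chains_def relation_of_def by blast
    have tot: "q \<le> r \<or> r \<le> q" if "q \<in> C" "r \<in> C" for q r
      using that C unfolding Chains_def relation_of_def P_def by blast
    define u where "u = (\<lambda>x. INF q\<in>C. q x)"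
    have bdd: "bdd_below ((\<lambda>q. q x) ` C)" for x
    proof (rule bdd_belowI2)
      fix q assume "q \<in> C"
      then have "sublinear q" "q (- x) \<le> p (- x)" using CA by (auto simp: A_def)
      then show "- p (- x) \<le> q x" using sublinearD(4)[of q x] by linarith
    qed
    have up: "u x \<le> q x" if "q \<in> C" for x q unfolding u_def by (rule cINF_lower[OF bdd that])
    have low: "d \<le> u x" if "\<And>q. q \<in> C \<Longrightarrow> d \<le> q x" for d x
      unfolding u_def by (rule cINF_greatest[OF False that])
    have "sublinear u"
    proof (rule sublinearI)
      fix x y
      have *: "u (x + y) - r y \<le> q x" if qr: "q \<in> C" "r \<in> C" for q r
      proof -
        \<comment> \<open>Subadditivity of an infimum needs one functional below both
          \<open>q\<close> and \<open>r\<close>; in a chain the smaller of the two serves.\<close>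
        obtain s where s: "s \<in> C" "s \<le> q" "s \<le> r" using tot[OF qr] qr by blast
        have "sublinear s" using CA s by (auto simp: A_def)
        then have "s (x + y) \<le> s x + s y" by (rule sublinearD)
        then show ?thesis using up[OF s(1), of "x + y"] s(2,3)[THEN le_funD, of x] s(3)[THEN le_funD, of y]
          by linarith
      qed
      then have "u (x + y) - r y \<le> u x" if "r \<in> C" for r using low that by blast
      then have "u (x + y) - u x \<le> r y" if "r \<in> C" for r using that by force
      then have "u (x + y) - u x \<le> u y" by (rule low)
      then show "u (x + y) \<le> u x + u y" by simp
    next
      have "q 0 = 0" if "q \<in> C" for q using CA[OF that] sublinearD(3) by (auto simp: A_def)
      then have "(\<lambda>q. q 0) ` C = {0}" using False by (auto simp: image_iff)
      then show "u 0 = 0" by (simp add: u_def)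
    next
      fix c :: real and x assume c: "0 < c"
      have "u (c *\<^sub>R x) / c \<le> q x" if "q \<in> C" for q
        using up[OF that, of "c *\<^sub>R x"] CA[OF that] sublinearD(2)[of q c x] c
        by (simp add: A_def field_simps)
      then have "u (c *\<^sub>R x) / c \<le> u x" by (rule low)
      then show "u (c *\<^sub>R x) \<le> c * u x" using c by (simp add: field_simps)
    qed
    moreover have "u x \<le> p x" for x
    proof -
      obtain q where "q \<in> C" using False by blast
      then show ?thesis using up[of q x] CA[of q] order_trans by (force simp: A_def)
    qed
    ultimately have "u \<in> A" by (simp add: A_def)
    then show ?thesis using up by (auto simp: P_def le_fun_def)
  qed
  from predicate_Zorn[OF po this] obtain m where m: "m \<in> A" "\<And>a. a \<in> A \<Longrightarrow> a \<le> m \<Longrightarrow> a = m"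
    unfolding P_def by blast
  have "linear m"
  proof (rule minimal_sublinear_linear)
    show "sublinear m" using m by (simp add: A_def)
    fix r assume r: "sublinear r" "\<And>x. r x \<le> m x"
    have "r x \<le> p x" for x using r(2)[of x] m(1) order_trans by (force simp: A_def)
    then show "r = m" using m(2)[of r] r by (simp add: A_def le_fun_def)
  qed
  then show thesis using that m(1) by (auto simp: A_def)
qed

text \<open>A linear minorant of the corrected functional lies above \<open>f\<close> on
  \<open>S\<close>; since \<open>S\<close> is a subspace, the same bound at \<open>- x\<close> gives
  equality.\<close>

lemma hahn_banach_extension:
  fixes p :: "'a::real_vector \<Rightarrow> real"
  assumes p: "sublinear p" and S: "subspace S"
    and fadd: "\<And>x y. x \<in> S \<Longrightarrow> y \<in> S \<Longrightarrow> f (x + y) = f x + f y"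
    and fscale: "\<And>c x. x \<in> S \<Longrightarrow> f (c *\<^sub>R x) = c * f x"
    and fle: "\<And>x. x \<in> S \<Longrightarrow> f x \<le> p x"
  obtains g where "linear g" and "\<And>x. g x \<le> p x" and "\<And>x. x \<in> S \<Longrightarrow> g x = f x"
proof -
  obtain q where q: "sublinear q" "\<And>x. q x \<le> p x" "\<And>s. s \<in> S \<Longrightarrow> q (- s) \<le> - f s"
    by (rule sublinear_inf_correction[where p = p and f = f and S = S,
      OF p subspace_0[OF S] subspace_add[OF S] subspace_scale[OF S] fadd fscale fle]) blast+
  obtain g where g: "linear g" "\<And>x. g x \<le> q x" using hahn_banach_sublinear[OF q(1)] by blast
  have neg: "g (- x) \<le> - f x" if "x \<in> S" for x
    using g(2)[of "- x"] q(3)[OF that] by simp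
  have "g x = f x" if x: "x \<in> S" for x
    using neg[OF x] neg[OF subspace_neg[OF S x]] fscale[OF x, of "- 1"] linear_neg[OF g(1), of x]
    by simp
  moreover have "g x \<le> p x" for x using g(2)[of x] q(2)[of x] by simp
  ultimately show thesis using that g(1) by blast
qed

lemma hahn_banach_point:
  fixes p :: "'a::real_vector \<Rightarrow> real"
  assumes p: "sublinear p"
  obtains g where "linear g" and "\<And>x. g x \<le> p x" and "g x0 = p x0"
proof (cases "x0 = 0")
  case True
  then show thesis using hahn_banach_sublinear[OF p] that sublinearD(3)[OF p] linear_0 by metis
next
  case False
  \<comment> \<open>The coefficient is unique because \<open>x0 \<noteq> 0\<close>; only the values
    on the line through \<open>x0\<close> matter.\<close>
  define f where "f = (\<lambda>x. p x0 * (SOME c. x = c *\<^sub>R x0))"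
  have f: "f (c *\<^sub>R x0) = c * p x0" for c
    using False by (simp add: f_def)
  have le: "c * p x0 \<le> p (c *\<^sub>R x0)" for c
  proof (cases "0 \<le> c")
    case False
    then have "p (- (c *\<^sub>R x0)) = - c * p x0" using sublinearD(2)[OF p, of "- c" x0] by simp
    then show ?thesis using sublinearD(4)[OF p, of "c *\<^sub>R x0"] by simp
  qed (simp add: sublinearD(2)[OF p])
  obtain g where "linear g" "\<And>x. g x \<le> p x" "\<And>x. x \<in> span {x0} \<Longrightarrow> g x = f x"
  proof (rule hahn_banach_extension[OF p subspace_span, of "{x0}" f])
    show "f (x + y) = f x + f y" if "x \<in> span {x0}" "y \<in> span {x0}" for x y
      using that f by (auto simp: span_singleton simp flip: scaleR_add_left) (simp add: algebra_simps)
    show "f (c *\<^sub>R x) = c * f x" if "x \<in> span {x0}" for c x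
      using that f by (auto simp: span_singleton)
    show "f x \<le> p x" if "x \<in> span {x0}" for x
      using that f le by (auto simp: span_singleton)
  qed blast
  then show thesis using that f[of 1] by (metis insertI1 mult_1 scaleR_one span_base)
qed

section \<open>Bounded functionals on normed spaces\<close>

lemma blinfun_of_dominated_linear:
  fixes g :: "'a::real_normed_vector \<Rightarrow> real"
  assumes g: "linear g" and le: "\<And>x. g x \<le> c * norm x" and "0 \<le> c"
  obtains F :: "'a dual" where "blinfun_apply F = g" and "norm F \<le> c"
proof -
  have abs: "\<bar>g x\<bar> \<le> c * norm x" for x
    using le[of x] le[of "- x"] linear_neg[OF g, of x] by simp
  have "bounded_linear g"
    using g abs by (intro bounded_linear_intro[where K = c])
      (auto simp: linear_add linear_cmul mult.commute)
  then have "blinfun_apply (Blinfun g) = g" by (rule bounded_linear_Blinfun_apply)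
  moreover from this have "norm (Blinfun g) \<le> c" using abs \<open>0 \<le> c\<close>
    by (intro norm_blinfun_bound) auto
  ultimately show thesis using that by blast
qed

lemma hahn_banach_norm_extension:
  fixes f :: "'a::real_normed_vector \<Rightarrow> real"
  assumes S: "subspace S"
    and fadd: "\<And>x y. x \<in> S \<Longrightarrow> y \<in> S \<Longrightarrow> f (x + y) = f x + f y"
    and fscale: "\<And>c x. x \<in> S \<Longrightarrow> f (c *\<^sub>R x) = c * f x"
    and fle: "\<And>x. x \<in> S \<Longrightarrow> f x \<le> c * norm x" and "0 \<le> c"
  obtains F :: "'a dual" where "norm F \<le> c" and "\<And>x. x \<in> S \<Longrightarrow> F x = f x"
proof -
  have p: "sublinear (\<lambda>x::'a. c * norm x)"
    using \<open>0 \<le> c\<close> by (auto simp: sublinear_def mult_left_mono norm_triangle_ineq simp flip: distrib_left)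
  obtain g where "linear g" "\<And>x. g x \<le> c * norm x" "\<And>x. x \<in> S \<Longrightarrow> g x = f x"
    by (rule hahn_banach_extension[OF p S fadd fscale fle]) blast+
  then show thesis using blinfun_of_dominated_linear[of g c] \<open>0 \<le> c\<close> that by metis
qed

text \<open>Correcting the norm by the zero functional on \<open>V\<close> gives the distance to
  \<open>V\<close>. A linear minorant attaining this distance at \<open>x\<close> vanishes on
  \<open>V\<close> and is at least \<open>d\<close> at \<open>x\<close>.\<close>

lemma hahn_banach_dist:
  fixes x :: "'a::real_normed_vector"
  assumes V: "subspace V" and d: "\<And>v. v \<in> V \<Longrightarrow> d \<le> norm (x - v)"
  obtains F :: "'a dual" where "norm F \<le> 1" and "\<And>v. v \<in> V \<Longrightarrow> F v = 0" and "d \<le> F x"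
proof -
  have n: "sublinear (norm :: 'a \<Rightarrow> real)" by (simp add: sublinear_def norm_triangle_ineq)
  obtain q where q: "sublinear q" "\<And>y. q y \<le> norm y" "\<And>v. v \<in> V \<Longrightarrow> q (- v) \<le> - 0"
    "\<And>d y. (\<And>s. s \<in> V \<Longrightarrow> d \<le> norm (y + s) - 0) \<Longrightarrow> d \<le> q y"
    by (rule sublinear_inf_correction[OF n subspace_0[OF V] subspace_add[OF V] subspace_scale[OF V], of "\<lambda>_. 0"])
      auto
  obtain g where g: "linear g" "\<And>y. g y \<le> q y" "g x = q x"
    using hahn_banach_point[OF q(1), of x] by blast
  have gv: "g v \<le> 0" if "v \<in> V" for v
    using g(2)[of v] q(3)[OF subspace_neg[OF V that]] by simp
  have "g v = 0" if "v \<in> V" for v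
    using gv[OF that] gv[OF subspace_neg[OF V that]] linear_neg[OF g(1), of v] by simp
  moreover have "d \<le> g x" unfolding g(3)
    using d subspace_neg[OF V] by (intro q(4)) (metis diff_minus_eq_add diff_zero)
  moreover have "g y \<le> 1 * norm y" for y using g(2)[of y] q(2)[of y] by simp
  ultimately show thesis using blinfun_of_dominated_linear[OF g(1), of 1] that by (metis zero_le_one)
qed

corollary norming_functional:
  fixes x :: "'a::real_normed_vector"
  obtains F :: "'a dual" where "norm F \<le> 1" and "norm x = F x"
proof -
  obtain F :: "'a dual" where F: "norm F \<le> 1" "norm x \<le> F x"
    by (rule hahn_banach_dist[of "{0}" "norm x" x]) (auto simp: subspace_def)
  have "F x \<le> norm F * norm x" using norm_blinfun[of F x] by simp
  also have "\<dots> \<le> 1 * norm x" using F(1) by (intro mult_right_mono) auto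
  finally show thesis using that F by simp
qed

lemma exists_nearly_norming:
  fixes F :: "'a::real_normed_vector dual"
  assumes "c < norm F"
  obtains x where "norm x \<le> 1" and "c < F x"
proof (cases "0 \<le> c")
  case True
  obtain x where x: "c * norm x < norm (F x)"
    using norm_blinfun_bound[OF True, of F] assms by (meson not_le)
  then have "x \<noteq> 0" by auto
  define y where "y = (sgn (F x) / norm x) *\<^sub>R x"
  have "F x \<noteq> 0" using x True by (metis mult_nonneg_nonneg norm_ge_zero norm_zero not_le)
  then have "norm y \<le> 1" "F y = norm (F x) / norm x"
    using \<open>x \<noteq> 0\<close> by (auto simp: y_def blinfun.scaleR_right sgn_if)
  moreover have "c < norm (F x) / norm x" using x \<open>x \<noteq> 0\<close> by (simp add: field_simps)
  ultimately show thesis using that by simp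
next
  case False
  then show thesis using that[of 0] by simp
qed

text \<open>The Banach-Alaoglu theorem for filters: the functionals of norm at most \<open>M\<close>
  lie in a product of compact intervals, and linearity and the bound survive pointwise
  limits.\<close>

lemma weak_star_cluster_filter:
  fixes G :: "'a::real_normed_vector dual filter"
  assumes G: "G \<noteq> bot" and bdd: "eventually (\<lambda>f. norm f \<le> M) G" 
  obtains g F where "F \<le> G" and "F \<noteq> bot" and "norm g \<le> M"
    and "\<And>x. ((\<lambda>f. blinfun_apply f x) \<longlongrightarrow> blinfun_apply g x) F"
proof -
  define K where "K = (PiE UNIV (\<lambda>x::'a. {- (M * norm x)..M * norm x}))"
  have "compactin (product_topology (\<lambda>i. euclidean) UNIV) K"
    unfolding K_def compactin_PiE by simp
  then have K: "compact K" by (simp add: euclidean_product_topology)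
  have "norm (blinfun_apply f x) \<le> M * norm x" if "norm f \<le> M" for f :: "'a dual" and x
    using norm_blinfun[of f x] mult_right_mono[OF that norm_ge_zero, of x] by linarith
  then have inK: "blinfun_apply f \<in> K" if "norm f \<le> M" for f :: "'a dual"
    using that by (simp add: K_def PiE_iff abs_le_iff) (metis minus_le_iff)
  obtain h where h: "h \<in> K" "inf (nhds h) (filtermap blinfun_apply G) \<noteq> bot"
  proof -
    have "filtermap blinfun_apply G \<noteq> bot" using G by (simp add: filtermap_bot_iff)
    moreover have "eventually (\<lambda>f. f \<in> K) (filtermap blinfun_apply G)"
      using bdd by (auto simp: eventually_filtermap elim!: eventually_mono intro: inK)
    ultimately show thesis using K that unfolding compact_filter by blast
  qed
  \<comment> \<open>So far \<open>h\<close> is only a cluster point of the image filter; meeting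
    \<open>G\<close> with the preimages of its neighbourhoods turns it into a limit.\<close>
  define F where "F = inf G (filtercomap blinfun_apply (nhds h))"
  have nb: "F \<noteq> bot"
  proof
    assume "F = bot"
    then have "eventually (\<lambda>_. False) F" by simp
    then obtain P Q where PQ: "eventually P G" "eventually Q (nhds h)" "\<And>f. P f \<Longrightarrow> Q (blinfun_apply f) \<Longrightarrow> False"
      unfolding F_def eventually_inf eventually_filtercomap by metis
    have "eventually (\<lambda>f. \<not> Q f) (filtermap blinfun_apply G)"
      using PQ by (auto simp: eventually_filtermap elim!: eventually_mono)
    then have "eventually (\<lambda>_. False) (inf (nhds h) (filtermap blinfun_apply G))"
      using PQ(2) unfolding eventually_inf by blast
    then show False using h(2) by (simp add: trivial_limit_def)
  qed
  have lim: "((\<lambda>f. blinfun_apply f x) \<longlongrightarrow> h x) F" for x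
  proof -
    have "((\<lambda>f::'a \<Rightarrow> real. f x) \<longlongrightarrow> h x) (nhds h)"
    proof (rule topological_tendstoI)
      fix S :: "real set" assume S: "open S" "h x \<in> S"
      have "open ((\<lambda>f::'a \<Rightarrow> real. f x) -` S)"
        by (rule open_vimage[OF S(1) continuous_on_product_coordinates])
      then show "eventually (\<lambda>f. f x \<in> S) (nhds h)"
        using S(2) by (auto simp: eventually_nhds)
    qed
    then have "((\<lambda>f. blinfun_apply f x) \<longlongrightarrow> h x) (filtercomap blinfun_apply (nhds h))"
      by (rule filterlim_compose) (rule filterlim_filtercomap)
    then show ?thesis unfolding F_def by (rule filterlim_mono) auto
  qed
  have "linear h"
  proof (rule linearI)
    fix x y
    have "((\<lambda>f. blinfun_apply f (x + y)) \<longlongrightarrow> h x + h y) F"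
      using tendsto_add[OF lim[of x] lim[of y]] by (simp add: blinfun.add_right)
    then show "h (x + y) = h x + h y" using tendsto_unique[OF nb lim] by blast
  next
    fix c :: real and x
    have "((\<lambda>f. blinfun_apply f (c *\<^sub>R x)) \<longlongrightarrow> c *\<^sub>R h x) F"
      using tendsto_scaleR[OF tendsto_const lim[of x], of c] by (simp add: blinfun.scaleR_right)
    then show "h (c *\<^sub>R x) = c *\<^sub>R h x" using tendsto_unique[OF nb lim] by blast
  qed
  moreover have "h x \<le> M * norm x" for x
    using h(1) by (auto simp: K_def PiE_UNIV_domain)
  moreover have "0 \<le> M"
    using eventually_happens'[OF G bdd] norm_ge_zero order_trans by blast
  ultimately obtain g :: "'a dual" where g: "blinfun_apply g = h" "norm g \<le> M"
    by (rule blinfun_of_dominated_linear)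
  show thesis
  proof (rule that[OF _ nb g(2)])
    show "F \<le> G" by (simp add: F_def)
  qed (use lim g(1) in simp)
qed

section \<open>Smooth renorming of spaces with separable dual\<close>

text \<open>The weights make the series converge for every sequence \<open>h\<close>, bounded or
  not. Pairing \<open>h k\<close> with \<open>- h k\<close> makes the sum even, so that its sublevel
  sets are symmetric.\<close>

definition smoothing_term :: "(nat \<Rightarrow> 'b::real_normed_vector) \<Rightarrow> 'b \<Rightarrow> nat \<Rightarrow> real" where
  "smoothing_term h f k = (1/2)^k / (1 + norm (h k))\<^sup>2 * ((norm (f - h k))\<^sup>2 + (norm (f + h k))\<^sup>2)"

definition smoothing :: "(nat \<Rightarrow> 'b::real_normed_vector) \<Rightarrow> 'b \<Rightarrow> real" where
  "smoothing h f = (\<Sum>k. smoothing_term h f k)"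

section \<open>Convergence, symmetry and coercivity of the smoothing series\<close>

lemma smoothing_term_nonneg: "0 \<le> smoothing_term h f k"
  by (simp add: smoothing_term_def)

lemma smoothing_term_le: "smoothing_term h f k \<le> 2 * (1 + norm f)\<^sup>2 * (1/2)^k"
proof -
  have le: "norm f + norm (h k) \<le> (1 + norm f) * (1 + norm (h k))" by (simp add: algebra_simps)
  have "norm (f - h k) \<le> (1 + norm f) * (1 + norm (h k))"
    using norm_triangle_ineq4[of f "h k"] le by linarith
  moreover have "norm (f + h k) \<le> (1 + norm f) * (1 + norm (h k))"
    using norm_triangle_ineq[of f "h k"] le by linarith
  ultimately have "(norm (f - h k))\<^sup>2 \<le> ((1 + norm f) * (1 + norm (h k)))\<^sup>2"
    "(norm (f + h k))\<^sup>2 \<le> ((1 + norm f) * (1 + norm (h k)))\<^sup>2"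
    by (auto intro: power_mono)
  then have "(norm (f - h k))\<^sup>2 + (norm (f + h k))\<^sup>2 \<le> 2 * ((1 + norm f) * (1 + norm (h k)))\<^sup>2"
    by linarith
  then have "smoothing_term h f k \<le> (1/2)^k / (1 + norm (h k))\<^sup>2 * (2 * ((1 + norm f) * (1 + norm (h k)))\<^sup>2)"
    unfolding smoothing_term_def by (rule mult_left_mono) simp
  moreover have "1 + norm (h k) \<noteq> 0" using norm_ge_zero[of "h k"] by linarith
  moreover have "(1/2)^k / d\<^sup>2 * (2 * (a * d)\<^sup>2) = 2 * a\<^sup>2 * (1/2)^k" if "d \<noteq> 0" for a d :: real
    using that by (simp add: power_mult_distrib)
  ultimately show ?thesis by metis
qed

lemma summable_smoothing_term: "summable (smoothing_term h f)"
proof (rule summable_comparison_test'[where N = 0])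
  show "summable (\<lambda>k. 2 * (1 + norm f)\<^sup>2 * (1/2)^k :: real)" by (intro summable_mult summable_geometric) simp
  show "norm (smoothing_term h f k) \<le> 2 * (1 + norm f)\<^sup>2 * (1/2)^k" for k
    using smoothing_term_le[of h f k] smoothing_term_nonneg[of h f k] by simp
qed

lemma smoothing_nonneg: "0 \<le> smoothing h f"
  unfolding smoothing_def by (intro suminf_nonneg summable_smoothing_term smoothing_term_nonneg)

lemma smoothing_le: "smoothing h f \<le> 4 * (1 + norm f)\<^sup>2"
proof -
  have s: "(\<lambda>k. 2 * (1 + norm f)\<^sup>2 * (1/2)^k) sums (2 * (1 + norm f)\<^sup>2 * (1 / (1 - 1/2)))"
    by (intro sums_mult geometric_sums) simp
  have "smoothing h f \<le> (\<Sum>k. 2 * (1 + norm f)\<^sup>2 * (1/2)^k)"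
    unfolding smoothing_def
    by (rule suminf_le[OF _ summable_smoothing_term sums_summable[OF s]]) (rule smoothing_term_le)
  then show ?thesis using sums_unique[OF s] by simp
qed

lemma smoothing_term_le_smoothing: "smoothing_term h f k \<le> smoothing h f"
proof -
  have "sum (smoothing_term h f) {k} \<le> suminf (smoothing_term h f)"
    by (rule sum_le_suminf[OF summable_smoothing_term]) (auto simp: smoothing_term_nonneg)
  then show ?thesis by (simp add: smoothing_def)
qed

lemma smoothing_uminus: "smoothing h (- f) = smoothing h f"
proof -
  have "smoothing_term h (- f) k = smoothing_term h f k" for k
  proof -
    have "- f - h k = - (f + h k)" "- f + h k = - (f - h k)" by simp_all
    then show ?thesis unfolding smoothing_term_def by (simp only: norm_minus_cancel add.commute)
  qed
  then show ?thesis by (simp add: smoothing_def)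
qed

text \<open>The term with \<open>k = 0\<close> alone controls \<open>norm f\<close>. The level 16 is
  the value of the bound \<open>4 * (1 + norm f)\<^sup>2\<close> at norm one, so this sublevel set
  also contains the unit ball.\<close>

lemma smoothing_bounded_sublevel:
  obtains M where "0 < M" and "\<And>f. smoothing h f \<le> 16 \<Longrightarrow> norm f \<le> M"
proof -
  define c where "c = 1 / (1 + norm (h 0))\<^sup>2"
  have "0 < 1 + norm (h 0)" by (simp add: add_pos_nonneg)
  then have c: "c > 0" unfolding c_def by (intro divide_pos_pos zero_less_power) auto
  have "norm f \<le> 8 / c + 1" if "smoothing h f \<le> 16" for f
  proof -
    have "2 *\<^sub>R f = (f - h 0) + (f + h 0)" by (simp add: scaleR_2)
    then have "2 * norm f \<le> norm (f - h 0) + norm (f + h 0)"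
      by (metis norm_triangle_ineq norm_scaleR abs_numeral)
    then have "(2 * norm f)\<^sup>2 \<le> (norm (f - h 0) + norm (f + h 0))\<^sup>2" by (intro power_mono) auto
    also have "\<dots> \<le> 2 * ((norm (f - h 0))\<^sup>2 + (norm (f + h 0))\<^sup>2)"
      using zero_le_power2[of "norm (f - h 0) - norm (f + h 0)"] by (simp add: power2_eq_square algebra_simps)
    finally have "2 * (norm f)\<^sup>2 \<le> (norm (f - h 0))\<^sup>2 + (norm (f + h 0))\<^sup>2" by (simp add: power_mult_distrib)
    then have "c * (2 * (norm f)\<^sup>2) \<le> smoothing_term h f 0"
      using c by (simp add: smoothing_term_def c_def divide_right_mono)
    then have "c * (2 * (norm f)\<^sup>2) \<le> 16" using smoothing_term_le_smoothing[of h f 0] that by linarith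
    then have *: "(norm f)\<^sup>2 \<le> 8 / c" using c by (simp add: field_simps)
    show ?thesis
    proof (rule ccontr)
      assume "\<not> ?thesis"
      then have "8 / c + 1 < norm f" by simp
      moreover have "0 \<le> 8 / c" using c by simp
      ultimately have "1 \<le> norm f" "8 / c < norm f" by linarith+
      then have "norm f \<le> (norm f)\<^sup>2" using mult_left_mono[of 1 "norm f" "norm f"] by (simp add: power2_eq_square)
      then show False using * \<open>8 / c < norm f\<close> by linarith
    qed
  qed
  then show thesis using that[of "8 / c + 1"] c by (simp add: add_pos_pos)
qed

section \<open>Convexity and the midpoint gap\<close>

lemma square_convex:
  fixes a b t :: real
  assumes "0 \<le> t" "t \<le> 1"
  shows "((1 - t) * a + t * b)\<^sup>2 \<le> (1 - t) * a\<^sup>2 + t * b\<^sup>2"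
proof -
  have "(1 - t) * a\<^sup>2 + t * b\<^sup>2 - ((1 - t) * a + t * b)\<^sup>2 = t * (1 - t) * (a - b)\<^sup>2"
    by (simp add: power2_eq_square algebra_simps)
  moreover have "0 \<le> t * (1 - t) * (a - b)\<^sup>2" using assms by simp
  ultimately show ?thesis by linarith
qed

lemma smoothing_convex:
  fixes f g :: "'b::real_normed_vector"
  assumes t: "0 \<le> t" "t \<le> 1"
  shows "smoothing h ((1 - t) *\<^sub>R f + t *\<^sub>R g) \<le> (1 - t) * smoothing h f + t * smoothing h g"
proof -
  have *: "(norm ((1 - t) *\<^sub>R f + t *\<^sub>R g - v))\<^sup>2 \<le> (1 - t) * (norm (f - v))\<^sup>2 + t * (norm (g - v))\<^sup>2" for v :: 'b
  proof -
    have "(1 - t) *\<^sub>R f + t *\<^sub>R g - v = (1 - t) *\<^sub>R (f - v) + t *\<^sub>R (g - v)"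
      by (simp add: algebra_simps)
    then have "norm ((1 - t) *\<^sub>R f + t *\<^sub>R g - v) \<le> (1 - t) * norm (f - v) + t * norm (g - v)"
      using norm_triangle_ineq[of "(1 - t) *\<^sub>R (f - v)" "t *\<^sub>R (g - v)"] t by simp
    then have "(norm ((1 - t) *\<^sub>R f + t *\<^sub>R g - v))\<^sup>2 \<le> ((1 - t) * norm (f - v) + t * norm (g - v))\<^sup>2"
      by (intro power_mono) auto
    also have "\<dots> \<le> (1 - t) * (norm (f - v))\<^sup>2 + t * (norm (g - v))\<^sup>2"
      by (rule square_convex[OF t])
    finally show ?thesis .
  qed
  have "smoothing_term h ((1 - t) *\<^sub>R f + t *\<^sub>R g) k \<le> (1 - t) * smoothing_term h f k + t * smoothing_term h g k" for k
  proof -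
    let ?c = "(1/2)^k / (1 + norm (h k))\<^sup>2"
    have "smoothing_term h ((1 - t) *\<^sub>R f + t *\<^sub>R g) k \<le> ?c * (((1 - t) * (norm (f - h k))\<^sup>2 + t * (norm (g - h k))\<^sup>2)
       + ((1 - t) * (norm (f + h k))\<^sup>2 + t * (norm (g + h k))\<^sup>2))"
      unfolding smoothing_term_def using *[of "h k"] *[of "- h k"] by (intro mult_left_mono add_mono) auto
    also have "\<dots> = (1 - t) * smoothing_term h f k + t * smoothing_term h g k"
      unfolding smoothing_term_def by algebra
    finally show ?thesis .
  qed
  moreover have "summable (\<lambda>k. (1 - t) * smoothing_term h f k + t * smoothing_term h g k)"
    by (intro summable_add summable_mult summable_smoothing_term)
  ultimately have "smoothing h ((1 - t) *\<^sub>R f + t *\<^sub>R g) \<le> (\<Sum>k. (1 - t) * smoothing_term h f k + t * smoothing_term h g k)"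
    unfolding smoothing_def by (intro suminf_le[OF _ summable_smoothing_term])
  also have "\<dots> = (1 - t) * smoothing h f + t * smoothing h g"
    unfolding smoothing_def
    by (subst suminf_add[symmetric]) (simp_all add: summable_mult summable_smoothing_term suminf_mult)
  finally show ?thesis .
qed

text \<open>The identity \<open>((a + b) / 2)\<^sup>2 = (a\<^sup>2 + b\<^sup>2) / 2 - (a -
  b)\<^sup>2 / 4\<close> gives a gap at every index. The gap at one \<open>k\<close> is kept: a
  small total gap then forces the distances of \<open>f\<close> and \<open>g\<close> to
  \<open>h k\<close> together.\<close>

lemma smoothing_midpoint:
  fixes f g :: "'b::real_normed_vector"
  shows "smoothing h ((1/2) *\<^sub>R (f + g)) \<le> (smoothing h f + smoothing h g) / 2
     - (1/2)^k / (1 + norm (h k))\<^sup>2 * (norm (f - h k) - norm (g - h k))\<^sup>2 / 4"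
proof -
  let ?c = "\<lambda>k. (1/2)^k / (1 + norm (h k))\<^sup>2"
  let ?d = "\<lambda>k. ?c k * (norm (f - h k) - norm (g - h k))\<^sup>2 / 4"
  have *: "(norm ((1/2) *\<^sub>R (f + g) - v))\<^sup>2 \<le> ((norm (f - v))\<^sup>2 + (norm (g - v))\<^sup>2) / 2
    - (norm (f - v) - norm (g - v))\<^sup>2 / 4" for v :: 'b
  proof -
    have "(1/2) *\<^sub>R (f + g) - v = (1/2) *\<^sub>R ((f - v) + (g - v))"
      by (simp add: algebra_simps flip: scaleR_add_left)
    then have "norm ((1/2) *\<^sub>R (f + g) - v) \<le> (norm (f - v) + norm (g - v)) / 2"
      using norm_triangle_ineq[of "f - v" "g - v"] by simp
    then have "(norm ((1/2) *\<^sub>R (f + g) - v))\<^sup>2 \<le> ((norm (f - v) + norm (g - v)) / 2)\<^sup>2"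
      by (intro power_mono) auto
    also have "\<dots> = ((norm (f - v))\<^sup>2 + (norm (g - v))\<^sup>2) / 2 - (norm (f - v) - norm (g - v))\<^sup>2 / 4"
      by (simp add: power2_eq_square field_simps)
    finally show ?thesis .
  qed
  have t: "smoothing_term h ((1/2) *\<^sub>R (f + g)) k + ?d k \<le> (1/2) * smoothing_term h f k + (1/2) * smoothing_term h g k" for k
  proof -
    have "(norm ((1/2) *\<^sub>R (f + g) + h k))\<^sup>2 \<le> ((norm (f + h k))\<^sup>2 + (norm (g + h k))\<^sup>2) / 2"
      using *[of "- h k"] zero_le_power2[of "norm (f + h k) - norm (g + h k)"]
      by (simp only: diff_minus_eq_add)
    then have "smoothing_term h ((1/2) *\<^sub>R (f + g)) k \<le> ?c k * ((((norm (f - h k))\<^sup>2 + (norm (g - h k))\<^sup>2) / 2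
      - (norm (f - h k) - norm (g - h k))\<^sup>2 / 4) + ((norm (f + h k))\<^sup>2 + (norm (g + h k))\<^sup>2) / 2)"
      unfolding smoothing_term_def using *[of "h k"] by (intro mult_left_mono add_mono) auto
    also have "\<dots> = (1/2) * smoothing_term h f k + (1/2) * smoothing_term h g k - ?d k"
    proof -
      have "c * (((a + b) / 2 - e / 4) + (a' + b') / 2) = (1/2) * (c * (a + a')) + (1/2) * (c * (b + b')) - c * e / 4"
        for a b a' b' c e :: real
        by (simp add: field_simps)
      then show ?thesis unfolding smoothing_term_def by blast
    qed
    finally show ?thesis by simp
  qed
  have d: "0 \<le> ?d k" for k by simp
  have s2: "summable (\<lambda>k. (1/2) * smoothing_term h f k + (1/2) * smoothing_term h g k)"
    by (intro summable_add summable_mult summable_smoothing_term)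
  have sd: "summable ?d"
  proof (rule summable_comparison_test'[where N = 0])
    show "summable (\<lambda>k. (1/2) * smoothing_term h f k + (1/2) * smoothing_term h g k)" by (rule s2)
    show "norm (?d k) \<le> (1/2) * smoothing_term h f k + (1/2) * smoothing_term h g k" for k
      using t[of k] d[of k] smoothing_term_nonneg[of h "(1/2) *\<^sub>R (f + g)" k] unfolding real_norm_def by linarith
  qed
  have "smoothing h ((1/2) *\<^sub>R (f + g)) + ?d k \<le> smoothing h ((1/2) *\<^sub>R (f + g)) + suminf ?d"
    using sum_le_suminf[OF sd, of "{k}"] d by simp
  also have "\<dots> = (\<Sum>k. smoothing_term h ((1/2) *\<^sub>R (f + g)) k + ?d k)"
    unfolding smoothing_def by (rule suminf_add[OF summable_smoothing_term sd])
  also have "\<dots> \<le> (\<Sum>k. (1/2) * smoothing_term h f k + (1/2) * smoothing_term h g k)"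
    by (rule suminf_le[OF t summable_add[OF summable_smoothing_term sd] s2])
  also have "\<dots> = (smoothing h f + smoothing h g) / 2"
    unfolding smoothing_def
    by (subst suminf_add[symmetric]) (simp_all add: summable_mult summable_smoothing_term suminf_divide)
  finally show ?thesis by linarith
qed

text \<open>A point nearly norming \<open>g - h\<close> witnesses the lower bound, since evaluation
  there converges along \<open>F\<close>.\<close>

lemma norm_weak_star_lsc:
  fixes g h :: "'a::real_normed_vector dual"
  assumes lim: "\<And>x. ((\<lambda>f. blinfun_apply f x) \<longlongrightarrow> blinfun_apply g x) F" and "0 < e"
  shows "eventually (\<lambda>f. norm (g - h) - e \<le> norm (f - h)) F"
proof -
  obtain x where x: "norm x \<le> 1" "norm (g - h) - e < blinfun_apply (g - h) x"
    using exists_nearly_norming[of "norm (g - h) - e" "g - h"] \<open>0 < e\<close> by auto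
  have "((\<lambda>f. blinfun_apply f x - h x) \<longlongrightarrow> blinfun_apply g x - h x) F" by (intro tendsto_diff lim tendsto_const)
  then have "eventually (\<lambda>f. norm (g - h) - e < blinfun_apply f x - h x) F"
    using x(2) by (intro order_tendstoD(1)[where y = "g x - h x"]) (auto simp: blinfun.diff_left)
  then show ?thesis
  proof (rule eventually_mono)
    fix f :: "'a dual" assume *: "norm (g - h) - e < blinfun_apply f x - h x"
    have "blinfun_apply f x - h x \<le> norm (f - h) * norm x"
      using norm_blinfun[of "f - h" x] by (simp add: blinfun.diff_left)
    also have "\<dots> \<le> norm (f - h) * 1" using x(1) by (intro mult_left_mono) auto
    finally show "norm (g - h) - e \<le> norm (f - h)" using * by simp
  qed
qed

text \<open>For a partial sum, the lower bounds on finitely many norms hold at one common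
  \<open>f\<close>; then the error \<open>e\<close> tends to zero, and the partial sums bound the
  series.\<close>

lemma smoothing_weak_star_lsc:
  fixes g :: "'a::real_normed_vector dual"
  assumes lim: "\<And>x. ((\<lambda>f. blinfun_apply f x) \<longlongrightarrow> blinfun_apply g x) F" and F: "F \<noteq> bot"
    and le: "eventually (\<lambda>f. smoothing h f \<le> R) F"
  shows "smoothing h g \<le> R"
proof -
  let ?c = "\<lambda>k. (1/2)^k / (1 + norm (h k))\<^sup>2"
  \<comment> \<open>Truncation at zero keeps squaring monotone when \<open>a - e\<close> is
    negative.\<close>
  let ?m = "\<lambda>(a::real) e. (max 0 (a - e))\<^sup>2"
  have "sum (smoothing_term h g) {..<n} \<le> R" for n
  proof -
    have *: "(\<Sum>k<n. ?c k * (?m (norm (g - h k)) e + ?m (norm (g + h k)) e)) \<le> R" if "0 < e" for e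
    proof -
      have lsc: "eventually (\<lambda>f. norm (g - v) - e \<le> norm (f - v)) F" for v
        by (rule norm_weak_star_lsc[OF lim that])
      have "eventually (\<lambda>f. norm (g - h k) - e \<le> norm (f - h k) \<and> norm (g + h k) - e \<le> norm (f + h k)) F" for k
        using lsc[of "h k"] lsc[of "- h k"] by (simp add: eventually_conj)
      then have "eventually (\<lambda>f. \<forall>k\<in>{..<n}. norm (g - h k) - e \<le> norm (f - h k) \<and> norm (g + h k) - e \<le> norm (f + h k)) F"
        by (intro eventually_ball_finite ballI) auto
      then obtain f where f: "\<And>k. k < n \<Longrightarrow> norm (g - h k) - e \<le> norm (f - h k)"
        "\<And>k. k < n \<Longrightarrow> norm (g + h k) - e \<le> norm (f + h k)" "smoothing h f \<le> R"
        using eventually_happens'[OF F eventually_conj[OF _ le]] by fastforce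
      have "(\<Sum>k<n. ?c k * (?m (norm (g - h k)) e + ?m (norm (g + h k)) e)) \<le> (\<Sum>k<n. smoothing_term h f k)"
        unfolding smoothing_term_def using f(1,2)
        by (intro sum_mono mult_left_mono add_mono power_mono) auto
      also have "\<dots> \<le> smoothing h f" unfolding smoothing_def
        by (intro sum_le_suminf summable_smoothing_term) (auto simp: smoothing_term_nonneg)
      finally show ?thesis using f(3) by simp
    qed
    have "((\<lambda>e. \<Sum>k<n. ?c k * (?m (norm (g - h k)) e + ?m (norm (g + h k)) e)) \<longlongrightarrow>
      (\<Sum>k<n. ?c k * (?m (norm (g - h k)) 0 + ?m (norm (g + h k)) 0))) (at_right 0)"
      by (intro tendsto_intros)
    moreover have "eventually (\<lambda>e. (\<Sum>k<n. ?c k * (?m (norm (g - h k)) e + ?m (norm (g + h k)) e)) \<le> R) (at_right 0)"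
      using * by (auto simp: eventually_at_right_field intro!: exI[of _ 1])
    ultimately have "(\<Sum>k<n. ?c k * (?m (norm (g - h k)) 0 + ?m (norm (g + h k)) 0)) \<le> R"
      by (rule tendsto_upperbound) simp
    then show ?thesis by (simp add: smoothing_term_def)
  qed
  then show ?thesis unfolding smoothing_def by (rule suminf_le_const[OF summable_smoothing_term])
qed

theorem frechet_norm_of_separable_dual:
  fixes h :: "nat \<Rightarrow> 'a::real_normed_vector dual"
  assumes dense: "closure (range h) = UNIV"
  shows "\<exists>p :: 'a \<Rightarrow> real. equivalent_norm p \<and> (\<forall>x. x \<noteq> 0 \<longrightarrow> frechet_differentiable_norm_at p x)"
proof -
  define B where "B = {f. smoothing h f \<le> 16}"
  define p where "p = (\<lambda>x. SUP f\<in>B. blinfun_apply f x)"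
  obtain M where M: "0 < M" "\<And>f. smoothing h f \<le> 16 \<Longrightarrow> norm f \<le> M"
    using smoothing_bounded_sublevel[of h] by blast
  have ball: "f \<in> B" if "norm f \<le> 1" for f
  proof -
    have "4 * (1 + norm f)\<^sup>2 \<le> 4 * 2\<^sup>2" using that by (intro mult_left_mono power_mono) auto
    then show ?thesis using smoothing_le[of h f] by (simp add: B_def)
  qed
  have B0: "B \<noteq> {}" using ball[of 0] by auto
  have sym: "- f \<in> B" if "f \<in> B" for f using that by (simp add: B_def smoothing_uminus)
  have apply_le: "blinfun_apply f x \<le> M * norm x" if "f \<in> B" for f x
  proof -
    have "norm f * norm x \<le> M * norm x" using M(2) that by (intro mult_right_mono) (auto simp: B_def)
    then show ?thesis using norm_blinfun[of f x] by simp
  qed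
  have bdd: "bdd_above ((\<lambda>f. blinfun_apply f x) ` B)" for x
    using apply_le by (intro bdd_aboveI2)
  have up: "blinfun_apply f x \<le> p x" if "f \<in> B" for f x
    unfolding p_def by (rule cSUP_upper[OF that bdd])
  have low: "p x \<le> d" if "\<And>f. f \<in> B \<Longrightarrow> blinfun_apply f x \<le> d" for d x
    unfolding p_def by (rule cSUP_least[OF B0 that])
  \<comment> \<open>The set \<open>B\<close> is bounded and contains the weak-star limits of its
    filters, so a cluster point of a maximizing sequence attains the supremum.\<close>
  have attain: "\<exists>f\<in>B. blinfun_apply f x = p x" for x
  proof -
    have "\<exists>f\<in>B. p x - inverse (real (Suc n)) < blinfun_apply f x" for n
    proof (rule ccontr)
      assume "\<not> ?thesis"
      then have "p x \<le> p x - inverse (real (Suc n))" by (intro low) (auto simp: not_less)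
      then show False by simp
    qed
    then obtain u where u: "\<And>n. u n \<in> B" "\<And>n. p x - inverse (real (Suc n)) < blinfun_apply (u n) x" by metis
    define G where "G = filtermap u sequentially"
    have "G \<noteq> bot" by (simp add: G_def filtermap_bot_iff)
    moreover have GB: "eventually (\<lambda>f. smoothing h f \<le> 16) G"
      using u(1) by (simp add: G_def eventually_filtermap B_def)
    then have "eventually (\<lambda>f. norm f \<le> M) G" by (rule eventually_mono) (rule M(2))
    ultimately obtain g F where F: "F \<le> G" "F \<noteq> bot" "\<And>y. ((\<lambda>f. blinfun_apply f y) \<longlongrightarrow> blinfun_apply g y) F"
      by (rule weak_star_cluster_filter) blast
    have "smoothing h g \<le> 16"
      by (rule smoothing_weak_star_lsc[OF F(3,2) filter_leD[OF F(1) GB]])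
    have "(\<lambda>n. p x - inverse (real (Suc n))) \<longlonglongrightarrow> p x - 0"
      by (intro tendsto_intros LIMSEQ_inverse_real_of_nat)
    then have lim: "(\<lambda>n. p x - inverse (real (Suc n))) \<longlonglongrightarrow> p x" by simp
    have "(\<lambda>n. blinfun_apply (u n) x) \<longlonglongrightarrow> p x"
      by (rule tendsto_sandwich[OF _ _ lim tendsto_const]) (use u up in \<open>auto intro!: always_eventually less_imp_le\<close>)
    then have "((\<lambda>f. blinfun_apply f x) \<longlongrightarrow> p x) G" by (simp add: G_def filterlim_filtermap)
    then have "((\<lambda>f. blinfun_apply f x) \<longlongrightarrow> p x) F" by (rule tendsto_mono[OF F(1)])
    then have "blinfun_apply g x = p x" using tendsto_unique[OF F(2) F(3)] by blast
    then show ?thesis using \<open>smoothing h g \<le> 16\<close> by (auto simp: B_def)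
  qed
  have ge: "norm x \<le> p x" for x
  proof -
    obtain F :: "'a dual" where "norm F \<le> 1" "norm x = F x" by (rule norming_functional)
    then show ?thesis using up[OF ball, of F x] by simp
  qed
  have padd: "p (x + y) \<le> p x + p y" for x y
    using up by (intro low) (simp add: blinfun.add_right add_mono)
  have pscale: "p (a *\<^sub>R x) = \<bar>a\<bar> * p x" for a x
  proof -
    have le: "p (a *\<^sub>R x) \<le> \<bar>a\<bar> * p x" for a x
    proof (rule low)
      fix f assume f: "f \<in> B"
      have "a * blinfun_apply f x = \<bar>a\<bar> * blinfun_apply (if 0 \<le> a then f else - f) x"
        by (simp add: blinfun.minus_left)
      also have "\<dots> \<le> \<bar>a\<bar> * p x" using f sym up by (intro mult_left_mono) auto
      finally show "blinfun_apply f (a *\<^sub>R x) \<le> \<bar>a\<bar> * p x" by (simp add: blinfun.scaleR_right)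
    qed
    show ?thesis
    proof (cases "a = 0")
      case True
      then show ?thesis using le[of 0 x] ge[of 0] by simp
    next
      case False
      have "p (inverse a *\<^sub>R a *\<^sub>R x) \<le> \<bar>inverse a\<bar> * p (a *\<^sub>R x)" by (rule le)
      then have "\<bar>a\<bar> * p x \<le> p (a *\<^sub>R x)" using False by (simp add: field_simps)
      then show ?thesis using le[of a x] by simp
    qed
  qed
  have p0: "0 \<le> p x" for x using ge[of x] norm_ge_zero[of x] by linarith
  have "is_norm p" unfolding is_norm_def
  proof (intro conjI allI)
    fix x
    show "p x = 0 \<longleftrightarrow> x = 0" using ge[of x] pscale[of 0 x] by auto
  qed (use p0 pscale padd in auto)
  moreover have "\<exists>c>0. \<exists>C>0. \<forall>x. c * norm x \<le> p x \<and> p x \<le> C * norm x"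
    using M(1) ge low[OF apply_le] by (intro exI[of _ "1::real"] exI[of _ M] conjI) auto
  ultimately have "equivalent_norm p" by (simp add: equivalent_norm_def)
  moreover have "frechet_differentiable_norm_at p x" if x: "x \<noteq> 0" for x
  proof -
    obtain f where f: "f \<in> B" "f x = p x" using attain by blast
    obtain w :: "'a dual" where w: "w x = p x + 1"
    proof -
      obtain F :: "'a dual" where F: "norm x = F x" by (rule norming_functional)
      then have "F x \<noteq> 0" using x by (metis norm_eq_zero)
      then show thesis using that[of "((p x + 1) / F x) *\<^sub>R F"] by (simp add: blinfun.scaleR_left)
    qed
    \<comment> \<open>Smulian's condition: functionals in \<open>B\<close> that nearly maximize the
      evaluation at \<open>x\<close> are close to \<open>f\<close> in norm.\<close>
    have exposed: "\<exists>d>0. \<forall>g\<in>B. p x - d < blinfun_apply g x \<longrightarrow> norm (g - f) < e" if e: "0 < e" for e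
    proof -
      obtain k where k: "norm (f - h k) < e / 4"
      proof -
        have "f \<in> closure (range h)" using dense by simp
        then have "\<exists>y\<in>range h. dist y f < e / 4"
          unfolding closure_approachable using e by (meson divide_pos_pos zero_less_numeral)
        then show thesis using that by (auto simp: dist_norm norm_minus_commute)
      qed
      define c where "c = (1/2)^k / (1 + norm (h k))\<^sup>2"
      \<comment> \<open>\<open>D\<close> bounds from below the midpoint gap of two functionals whose
        distances to \<open>h k\<close> differ by at least \<open>e / 2\<close>. The choice of
        \<open>l\<close> gives \<open>l * (D + K) = D\<close>, so a step of length \<open>l\<close>
        from the midpoint towards \<open>w\<close> costs no more than this gap.\<close>
      define D where "D = c * (e / 2)\<^sup>2 / 4"
      define K where "K = smoothing h w"
      define l where "l = D / (D + K)"
      have "0 < 1 + norm (h k)" by (simp add: add_pos_nonneg)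
      then have c: "c > 0" unfolding c_def by (intro divide_pos_pos zero_less_power) auto
      then have D: "D > 0" using e by (simp add: D_def)
      have K: "0 \<le> K" by (simp add: K_def smoothing_nonneg)
      have l: "0 < l" "l \<le> 1" using D K by (auto simp: l_def field_simps)
      \<comment> \<open>The midpoint halves the deficit at \<open>x\<close>: a loss below
        \<open>2 * l\<close> for \<open>g\<close> is a loss below \<open>l\<close> for
        \<open>m\<close>, which the step towards \<open>w\<close> more than recovers.\<close>
      have "norm (g - f) < e" if g: "g \<in> B" "p x - 2 * l < blinfun_apply g x" for g
      proof (rule ccontr)
        assume "\<not> ?thesis"
        then have "e \<le> norm (g - f)" by simp
        also have "\<dots> \<le> norm (g - h k) + norm (f - h k)"
          using norm_triangle_ineq4[of "g - h k" "f - h k"] by simp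
        finally have gap: "e / 2 \<le> norm (g - h k) - norm (f - h k)" using k by linarith
        define m where "m = (1/2) *\<^sub>R (g + f)"
        have "(e / 2)\<^sup>2 \<le> (norm (g - h k) - norm (f - h k))\<^sup>2" using gap e by (intro power_mono) auto
        then have D_le: "D \<le> c * (norm (g - h k) - norm (f - h k))\<^sup>2 / 4" unfolding D_def using c by simp
        have "smoothing h m \<le> (smoothing h g + smoothing h f) / 2 - D"
          using smoothing_midpoint[of h g f k, folded c_def m_def] diff_left_mono[OF D_le] by (rule order_trans)
        moreover have "(smoothing h g + smoothing h f) / 2 \<le> 16" using g(1) f(1) by (simp add: B_def)
        ultimately have m: "smoothing h m \<le> 16 - D" by (meson diff_right_mono order_trans)
        \<comment> \<open>The slack \<open>D\<close> at the midpoint \<open>m\<close> allows a step towards \<open>w\<close>, where the evaluation at \<open>x\<close>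
          exceeds \<open>p x\<close>, without leaving \<open>B\<close>.\<close>
        have "smoothing h ((1 - l) *\<^sub>R m + l *\<^sub>R w) \<le> (1 - l) * smoothing h m + l * K"
          unfolding K_def using l by (intro smoothing_convex) auto
        also have "\<dots> \<le> (1 - l) * (16 - D) + l * K" using m l by (intro add_mono mult_left_mono) auto
        also have "\<dots> = 16 - D - l * 16 + l * (D + K)" by (simp add: algebra_simps)
        also have "l * (D + K) = D" using D K by (simp add: l_def)
        also have "16 - D - l * 16 + D \<le> 16" using l by simp
        finally have "(1 - l) *\<^sub>R m + l *\<^sub>R w \<in> B" by (simp add: B_def)
        from up[OF this, of x] have "(1 - l) * m x + l * (p x + 1) \<le> p x"
          by (simp add: blinfun.add_left blinfun.scaleR_left w)
        then have 1: "(1 - l) * m x + l * p x \<le> p x - l" by (simp add: algebra_simps)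
        have mx: "m x = (g x + p x) / 2" using f(2) by (simp add: m_def blinfun.add_left blinfun.scaleR_left)
        have "p x - l < m x" using g(2) mx by simp
        moreover have "m x \<le> p x" using up[OF g(1), of x] mx by simp
        then have "l * m x \<le> l * p x" using l by (intro mult_left_mono) auto
        then have "m x \<le> (1 - l) * m x + l * p x" by (simp add: algebra_simps)
        ultimately show False using 1 by linarith
      qed
      then show ?thesis using l by (intro exI[of _ "2 * l"]) auto
    qed
    have "uniform_limit {y. p y = 1} (\<lambda>t y. (p (x + t *\<^sub>R y) - p x) / t) (blinfun_apply f) (at 0)"
    proof (rule uniform_limitI)
      fix e :: real assume "0 < e"
      from exposed[OF this] obtain d where d: "d > 0"
        "\<And>g. g \<in> B \<Longrightarrow> p x - d < blinfun_apply g x \<Longrightarrow> norm (g - f) < e" by blast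
      have "dist ((p (x + t *\<^sub>R y) - p x) / t) (f y) < e"
        if t: "t \<noteq> 0" "\<bar>t\<bar> < d / 2" and y: "p y = 1" for t y
      proof -
        \<comment> \<open>A maximizer at \<open>x + t *\<^sub>R y\<close> loses at most
          \<open>2 * \<bar>t\<bar>\<close> at \<open>x\<close>, which is less than \<open>d\<close>,
          so it is norm-close to \<open>f\<close>. The difference quotient lies between
          \<open>f y\<close> and \<open>g y\<close>, and \<open>norm y \<le> p y = 1\<close> makes
          the estimate uniform.\<close>
        obtain g where g: "g \<in> B" "g (x + t *\<^sub>R y) = p (x + t *\<^sub>R y)" using attain by blast
        have gx: "g x + t * g y = p (x + t *\<^sub>R y)" using g(2) by (simp add: blinfun.add_right blinfun.scaleR_right)
        have "g x \<le> p x" by (rule up[OF g(1)])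
        have lower: "p x + t * f y \<le> p (x + t *\<^sub>R y)"
          using up[OF f(1), of "x + t *\<^sub>R y"] f(2) by (simp add: blinfun.add_right blinfun.scaleR_right)
        have "p x \<le> p (x + t *\<^sub>R y) + p ((- t) *\<^sub>R y)" using padd[of "x + t *\<^sub>R y" "(- t) *\<^sub>R y"] by simp
        then have 1: "p x - \<bar>t\<bar> \<le> p (x + t *\<^sub>R y)" using pscale[of "- t" y] y by simp
        have "t * g y \<le> \<bar>t\<bar>" using up[OF g(1), of "t *\<^sub>R y"] pscale[of t y] y by (simp add: blinfun.scaleR_right)
        then have "norm (g - f) < e" using 1 gx t(2) by (intro d(2) g(1)) linarith
        moreover have "norm y \<le> 1" using ge[of y] y by simp
        ultimately have "norm (g - f) * norm y < e" 
          using mult_left_le[of "norm y" "norm (g - f)"] by simp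
        then have diff: "\<bar>g y - f y\<bar> < e" using norm_blinfun[of "g - f" y] by (simp add: blinfun.diff_left)
        have "\<bar>p (x + t *\<^sub>R y) - p x - t * f y\<bar> \<le> \<bar>t * (g y - f y)\<bar>"
          using lower gx \<open>g x \<le> p x\<close> by (simp add: algebra_simps)
        then have "\<bar>p (x + t *\<^sub>R y) - p x - t * f y\<bar> < \<bar>t\<bar> * e"
          using diff t(1) by (simp add: abs_mult) (smt (verit) mult_less_cancel_left_pos)
        moreover have "(p (x + t *\<^sub>R y) - p x) / t - f y = (p (x + t *\<^sub>R y) - p x - t * f y) / t"
          using t(1) by (simp add: field_simps)
        ultimately show ?thesis using t(1) by (simp add: dist_real_def abs_divide pos_divide_less_eq mult.commute)
      qed
      then show "\<forall>\<^sub>F t in at 0. \<forall>y\<in>{y. p y = 1}. dist ((p (x + t *\<^sub>R y) - p x) / t) (f y) < e"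
        unfolding eventually_at using d(1) by (intro exI[of _ "d / 2"]) auto
    qed
    then show ?thesis unfolding frechet_differentiable_norm_at_def by blast
  qed
  ultimately show ?thesis by blast
qed

section \<open>Almost biorthogonal systems\<close>

text \<open>The tolerance 1/2 off the diagonal admits systems that are biorthogonal only up to an
  error, such as those obtained from a tree. The bound \<open>K\<close> is common to all points of
  \<open>P\<close>.\<close>

definition almost_biorthogonal :: "'b::real_normed_vector set \<Rightarrow> bool" where
  "almost_biorthogonal P \<longleftrightarrow> bounded P \<and>
     (\<exists>K. \<forall>p\<in>P. \<exists>\<Phi>::'b dual. norm \<Phi> \<le> K \<and> blinfun_apply \<Phi> p = 1 \<and> (\<forall>q\<in>P - {p}. \<bar>blinfun_apply \<Phi> q\<bar> \<le> 1/2))"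

lemma almost_biorthogonalI:
  fixes P :: "'b::real_normed_vector set"
  assumes "bounded P" and a: "0 < a"
    and ex: "\<And>p. p \<in> P \<Longrightarrow> \<exists>\<Phi>::'b dual. norm \<Phi> \<le> K \<and> a \<le> blinfun_apply \<Phi> p \<and> (\<forall>q\<in>P - {p}. \<bar>blinfun_apply \<Phi> q\<bar> \<le> a / 2)"
  shows "almost_biorthogonal P"
  unfolding almost_biorthogonal_def
proof (intro conjI exI[of _ "K / a"] ballI)
  fix p assume "p \<in> P"
  then obtain \<Phi> :: "'b dual" where \<Phi>: "norm \<Phi> \<le> K" "a \<le> \<Phi> p" "\<And>q. q \<in> P - {p} \<Longrightarrow> \<bar>\<Phi> q\<bar> \<le> a / 2"
    using ex by blast
  have pos: "0 < \<Phi> p" using a \<Phi>(2) by simp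
  show "\<exists>\<Phi>::'b dual. norm \<Phi> \<le> K / a \<and> blinfun_apply \<Phi> p = 1 \<and> (\<forall>q\<in>P - {p}. \<bar>blinfun_apply \<Phi> q\<bar> \<le> 1/2)"
  proof (intro exI[of _ "inverse (\<Phi> p) *\<^sub>R \<Phi>"] conjI ballI)
    have "norm \<Phi> / \<Phi> p \<le> K / a" using \<Phi>(1,2) a by (intro frac_le) (auto intro: order_trans[OF norm_ge_zero])
    then show "norm (inverse (\<Phi> p) *\<^sub>R \<Phi>) \<le> K / a" using pos by (simp add: field_simps)
    show "blinfun_apply (inverse (\<Phi> p) *\<^sub>R \<Phi>) p = 1" using pos by (simp add: blinfun.scaleR_left)
    fix q assume "q \<in> P - {p}"
    then have "\<bar>\<Phi> q\<bar> \<le> \<Phi> p / 2" using \<Phi>(2) \<Phi>(3)[of q] by linarith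
    then show "\<bar>blinfun_apply (inverse (\<Phi> p) *\<^sub>R \<Phi>) q\<bar> \<le> 1/2"
      using pos by (simp add: blinfun.scaleR_left abs_mult field_simps)
  qed
qed (rule assms(1))

text \<open>Its use is with countably many functionals or half-spaces: one of them must separate two
  distinct points from a ball, and then their midpoint as well.\<close>

lemma uncountable_pigeonhole:
  assumes "uncountable P" and "countable X" and "\<And>p. p \<in> P \<Longrightarrow> \<exists>x\<in>X. R p x"
  obtains x p q where "x \<in> X" "p \<in> P" "q \<in> P" "p \<noteq> q" "R p x" "R q x"
proof -
  obtain f where f: "\<And>p. p \<in> P \<Longrightarrow> f p \<in> X \<and> R p (f p)" using assms(3) by metis
  have "countable (f ` P)" using assms(2) f by (auto intro: countable_subset[of _ X])
  then have "\<not> inj_on f P" using assms(1) countable_image_inj_on by blast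
  then show thesis using f that unfolding inj_on_def by metis
qed

text \<open>The norm is defined by duality, as a supremum over a symmetric set \<open>E\<close> of
  functionals. The bound on sums is built into \<open>E\<close>, and each point of \<open>P\<close>
  is kept outside the unit ball by a multiple of its own functional, which still belongs to
  \<open>E\<close>.\<close>

lemma almost_biorthogonal_norm:
  fixes P :: "'b::real_normed_vector set"
  assumes P: "almost_biorthogonal P"
  obtains N where "equivalent_norm N" and "\<And>p q. p \<in> P \<Longrightarrow> q \<in> P \<Longrightarrow> p \<noteq> q \<Longrightarrow> N (p + q) \<le> 2"
    and "\<And>p. p \<in> P \<Longrightarrow> \<exists>\<Phi>::'b dual. 1 < blinfun_apply \<Phi> p \<and> (\<forall>y. \<bar>blinfun_apply \<Phi> y\<bar> \<le> N y)"
proof -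
  obtain M where M: "0 < M" "\<And>p. p \<in> P \<Longrightarrow> norm p \<le> M"
    using P by (auto simp: almost_biorthogonal_def bounded_pos)
  obtain K where K: "\<And>p. p \<in> P \<Longrightarrow> \<exists>\<Phi>::'b dual. norm \<Phi> \<le> K \<and> blinfun_apply \<Phi> p = 1 \<and> (\<forall>q\<in>P - {p}. \<bar>blinfun_apply \<Phi> q\<bar> \<le> 1/2)"
    using P by (auto simp: almost_biorthogonal_def)
  \<comment> \<open>\<open>R\<close> leaves room for the multiples by 4/3 used below and is at least
    one. The choice of \<open>r\<close> gives values at most one on \<open>P\<close> to all
    functionals of norm at most \<open>r\<close>, so \<open>E\<close> contains a ball and
    \<open>N\<close> dominates a multiple of the norm.\<close>
  define R where "R = 4/3 * \<bar>K\<bar> + 1"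
  define r where "r = min 1 (1 / M)"
  define E where "E = {\<Phi>::'b dual. norm \<Phi> \<le> R \<and> (\<forall>p\<in>P. \<forall>q\<in>P. p \<noteq> q \<longrightarrow> \<bar>blinfun_apply \<Phi> (p + q)\<bar> \<le> 2)}"
  define N where "N = (\<lambda>y. SUP \<Phi>\<in>E. \<bar>blinfun_apply \<Phi> y\<bar>)"
  have R: "0 < R" "1 \<le> R" by (auto simp: R_def)
  have r: "0 < r" "r \<le> 1" "r * M \<le> 1" using M(1) by (auto simp: r_def min_def field_simps)
  have small: "\<Phi> \<in> E" if "norm \<Phi> \<le> r" for \<Phi>
  proof -
    have "\<bar>blinfun_apply \<Phi> p\<bar> \<le> 1" if "p \<in> P" for p
    proof -
      have "norm \<Phi> * norm p \<le> r * M" using \<open>norm \<Phi> \<le> r\<close> M that r(1) by (intro mult_mono) auto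
      then show ?thesis using norm_blinfun[of \<Phi> p] r(3) by simp
    qed
    then have "\<bar>blinfun_apply \<Phi> (p + q)\<bar> \<le> 2" if "p \<in> P" "q \<in> P" for p q
      using that by (simp add: blinfun.add_right) (smt (verit))
    then show ?thesis using that r(2) R(2) by (simp add: E_def)
  qed
  from this[of 0] have E0: "E \<noteq> {}" using r(1) by auto
  have apply_le: "\<bar>blinfun_apply \<Phi> y\<bar> \<le> R * norm y" if "\<Phi> \<in> E" for \<Phi> y
  proof -
    have "norm \<Phi> * norm y \<le> R * norm y" using that by (intro mult_right_mono) (auto simp: E_def)
    then show ?thesis using norm_blinfun[of \<Phi> y] by simp
  qed
  then have bdd: "bdd_above ((\<lambda>\<Phi>. \<bar>blinfun_apply \<Phi> y\<bar>) ` E)" for y by (intro bdd_aboveI2)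
  have up: "\<bar>blinfun_apply \<Phi> y\<bar> \<le> N y" if "\<Phi> \<in> E" for \<Phi> y
    unfolding N_def by (rule cSUP_upper[OF that bdd])
  have low: "N y \<le> d" if "\<And>\<Phi>. \<Phi> \<in> E \<Longrightarrow> \<bar>blinfun_apply \<Phi> y\<bar> \<le> d" for d y
    unfolding N_def by (rule cSUP_least[OF E0 that])
  have ge: "r * norm y \<le> N y" for y
  proof -
    obtain F :: "'b dual" where F: "norm F \<le> 1" "norm y = F y" by (rule norming_functional)
    then have "norm (r *\<^sub>R F) \<le> r" using r mult_left_mono[of "norm F" 1 r] by simp
    then have "r *\<^sub>R F \<in> E" by (rule small)
    from up[OF this, of y] show ?thesis using F(2) norm_ge_zero[of y] r(1)
      by (simp add: blinfun.scaleR_left abs_mult)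
  qed
  have N0: "0 \<le> N y" for y using ge[of y] r(1) by (meson mult_nonneg_nonneg less_imp_le norm_ge_zero order_trans)
  have scale: "N (a *\<^sub>R y) = \<bar>a\<bar> * N y" for a y
  proof -
    have le: "N (a *\<^sub>R y) \<le> \<bar>a\<bar> * N y" for a y
      using up by (intro low) (simp add: blinfun.scaleR_right abs_mult mult_left_mono)
    show ?thesis
    proof (cases "a = 0")
      case True
      then show ?thesis using le[of 0 y] N0[of 0] by simp
    next
      case False
      have "N (inverse a *\<^sub>R a *\<^sub>R y) \<le> \<bar>inverse a\<bar> * N (a *\<^sub>R y)" by (rule le)
      then have "\<bar>a\<bar> * N y \<le> N (a *\<^sub>R y)" using False by (simp add: field_simps)
      then show ?thesis using le[of a y] by simp
    qed
  qed
  have add: "N (x + y) \<le> N x + N y" for x y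
  proof (rule low)
    fix \<Phi> assume "\<Phi> \<in> E"
    then show "\<bar>blinfun_apply \<Phi> (x + y)\<bar> \<le> N x + N y"
      using up[of \<Phi> x] up[of \<Phi> y] by (simp add: blinfun.add_right)
  qed
  show thesis
  proof (rule that)
    have "N y = 0 \<longleftrightarrow> y = 0" for y
      using ge[of y] r(1) scale[of 0 y] by (auto simp: mult_le_0_iff)
    then have "is_norm N" unfolding is_norm_def using N0 scale add by blast
    then show "equivalent_norm N"
      unfolding equivalent_norm_def using r(1) R(1) ge low[OF apply_le] by blast
    show "N (p + q) \<le> 2" if "p \<in> P" "q \<in> P" "p \<noteq> q" for p q
      using that by (intro low) (auto simp: E_def)
    show "\<exists>\<Phi>::'b dual. 1 < blinfun_apply \<Phi> p \<and> (\<forall>y. \<bar>blinfun_apply \<Phi> y\<bar> \<le> N y)" if p: "p \<in> P" for p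
    proof -
      obtain \<Phi> :: "'b dual" where \<Phi>: "norm \<Phi> \<le> K" "blinfun_apply \<Phi> p = 1" "\<And>q. q \<in> P - {p} \<Longrightarrow> \<bar>blinfun_apply \<Phi> q\<bar> \<le> 1/2"
        using K[OF p] by blast
      \<comment> \<open>The worst case is \<open>1 + 1/2\<close>, when one of the points is
        \<open>p\<close>. Scaling by 4/3 turns this into the permitted 2, while the value at
        \<open>p\<close> becomes 4/3, above one.\<close>
      have "\<bar>blinfun_apply \<Phi> (q + s)\<bar> \<le> 3/2" if "q \<in> P" "s \<in> P" "q \<noteq> s" for q s
      proof -
        have "\<bar>blinfun_apply \<Phi> q\<bar> + \<bar>blinfun_apply \<Phi> s\<bar> \<le> 3/2"
          using \<Phi>(2) \<Phi>(3)[of q] \<Phi>(3)[of s] that by (cases "q = p"; cases "s = p") auto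
        then show ?thesis
          using abs_triangle_ineq[of "\<Phi> q" "\<Phi> s"] by (simp add: blinfun.add_right)
      qed
      moreover have "4/3 * norm \<Phi> \<le> R" using \<Phi>(1) by (simp add: R_def)
      ultimately have "(4/3) *\<^sub>R \<Phi> \<in> E"
        by (force simp: E_def blinfun.scaleR_left abs_mult)
      from up[OF this] show ?thesis using \<Phi>(2)
        by (intro exI[of _ "(4/3) *\<^sub>R \<Phi>"]) (simp add: blinfun.scaleR_left)
    qed
  qed
qed

text \<open>One set serves against both separability conditions, because a dual ball is itself
  weak-star closed and convex. Its predual unit ball serves against constructibility.\<close>

theorem uncountable_almost_biorthogonal:
  fixes P :: "'b::real_normed_vector set"
  assumes P: "almost_biorthogonal P" "uncountable P"
  shows "\<exists>B::'b dual set. dual_ball B \<and> closedin weak_star B \<and> convex B \<and> \<not> weak_star_separable B"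
    and "\<exists>C::'b set. closed C \<and> convex C \<and> \<not> constructible C"
proof -
  obtain N where N: "equivalent_norm N" "\<And>p q. p \<in> P \<Longrightarrow> q \<in> P \<Longrightarrow> p \<noteq> q \<Longrightarrow> N (p + q) \<le> 2"
    "\<And>p. p \<in> P \<Longrightarrow> \<exists>\<Phi>::'b dual. 1 < blinfun_apply \<Phi> p \<and> (\<forall>y. \<bar>blinfun_apply \<Phi> y\<bar> \<le> N y)"
    using almost_biorthogonal_norm[OF P(1)] by blast
  have scale: "N (a *\<^sub>R y) = \<bar>a\<bar> * N y" and add: "N (x + y) \<le> N x + N y" for a x y
    using N(1) by (auto simp: equivalent_norm_def is_norm_def)
  obtain c C where c: "0 < c" "0 < C" "\<And>y. c * norm y \<le> N y" "\<And>y. N y \<le> C * norm y"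
    using N(1) unfolding equivalent_norm_def by blast
  have N0: "N 0 = 0" using scale[of 0 0] by simp
  have mid: "N ((1/2) *\<^sub>R (p + q)) \<le> 1" if "p \<in> P" "q \<in> P" "p \<noteq> q" for p q
    using N(2)[OF that] by (simp add: scale)

  define B where "B = {F. dual_norm N F \<le> 1}"
  have bdd: "bdd_above ((\<lambda>y. \<bar>blinfun_apply F y\<bar>) ` {y. N y \<le> 1})" for F :: "'b dual"
  proof (rule bdd_aboveI2)
    fix y assume "y \<in> {y. N y \<le> 1}"
    then have "c * norm y \<le> 1" using c(3)[of y] by simp
    then have "norm y \<le> 1 / c" using c(1) by (simp add: field_simps)
    then have "norm F * norm y \<le> norm F * (1 / c)" by (intro mult_left_mono) auto
    then show "\<bar>F y\<bar> \<le> norm F * (1 / c)" using norm_blinfun[of F y] by simp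
  qed
  have B_iff: "F \<in> B \<longleftrightarrow> (\<forall>y. N y \<le> 1 \<longrightarrow> \<bar>blinfun_apply F y\<bar> \<le> 1)" for F
  proof
    assume "F \<in> B"
    then show "\<forall>y. N y \<le> 1 \<longrightarrow> \<bar>blinfun_apply F y\<bar> \<le> 1"
      using cSUP_upper[OF _ bdd, of _ F] unfolding B_def dual_norm_def by fastforce
  next
    assume "\<forall>y. N y \<le> 1 \<longrightarrow> \<bar>blinfun_apply F y\<bar> \<le> 1"
    then show "F \<in> B" unfolding B_def dual_norm_def mem_Collect_eq using N0
      by (intro cSUP_least) (auto intro: exI[of "\<lambda>x. N x \<le> 1" 0])
  qed
  have "dual_ball B" using N(1) by (auto simp: dual_ball_def B_def)
  moreover have "closedin weak_star B"
  proof -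
    have cl: "closedin weak_star {F \<in> topspace weak_star. blinfun_apply F y \<in> {-1..1}}" for y :: 'b
      by (rule closedin_continuous_map_preimage[OF strong_operator_topology_continuous_evaluation]) simp
    have eq: "B = (\<Inter>y\<in>{y. N y \<le> 1}. {F \<in> topspace weak_star. blinfun_apply F y \<in> {-1..1}})"
      by (auto simp: B_iff strong_operator_topology_topspace abs_le_iff)
    have "0 \<in> {y. N y \<le> 1}" using N0 by simp
    then have "{y. N y \<le> 1} \<noteq> {}" by blast
    then show ?thesis unfolding eq by (rule closedin_INT) (rule cl)
  qed
  moreover have "convex B"
  proof (rule convexI)
    fix F G and u v :: real assume FG: "F \<in> B" "G \<in> B" and uv: "0 \<le> u" "0 \<le> v" "u + v = 1"
    show "u *\<^sub>R F + v *\<^sub>R G \<in> B"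
      unfolding B_iff
    proof (intro allI impI)
      fix y assume "N y \<le> 1"
      then have "\<bar>F y\<bar> \<le> 1" "\<bar>G y\<bar> \<le> 1" using FG B_iff by auto
      then have "u * \<bar>F y\<bar> + v * \<bar>G y\<bar> \<le> u * 1 + v * 1" using uv by (intro add_mono mult_left_mono)
      then show "\<bar>(u *\<^sub>R F + v *\<^sub>R G) y\<bar> \<le> 1"
        using uv abs_triangle_ineq[of "u * F y" "v * G y"]
        by (simp add: blinfun.add_left blinfun.scaleR_left abs_mult)
    qed
  qed
  moreover have "\<not> weak_star_separable B"
  proof
    assume "weak_star_separable B"
    then obtain D where D: "countable D" "D \<subseteq> B" "subtopology weak_star B closure_of D = B"
      unfolding weak_star_separable_def by blast
    \<comment> \<open>Exceeding one at \<open>p\<close> is a weak-star open condition met by some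
      functional in \<open>B\<close>, hence also by some functional in the dense set
      \<open>D\<close>.\<close>
    have ex: "\<exists>\<Psi>\<in>D. 1 < blinfun_apply \<Psi> p" if p: "p \<in> P" for p
    proof -
      obtain \<Phi> :: "'b dual" where \<Phi>: "1 < blinfun_apply \<Phi> p" "\<And>y. \<bar>blinfun_apply \<Phi> y\<bar> \<le> N y" using N(3)[OF p] by blast
      have "\<Phi> \<in> B" using \<Phi>(2) order_trans by (auto simp: B_iff)
      then have "\<Phi> \<in> subtopology weak_star B closure_of D" using D(3) by simp
      moreover have "openin weak_star {F \<in> topspace weak_star. blinfun_apply F p \<in> {1<..}}"
        by (rule openin_continuous_map_preimage[OF strong_operator_topology_continuous_evaluation]) simp
      then have "openin (subtopology weak_star B) ({F. 1 < blinfun_apply F p} \<inter> B)"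
        by (auto simp: openin_subtopology strong_operator_topology_topspace)
      moreover have "\<Phi> \<in> {F. 1 < blinfun_apply F p} \<inter> B" using \<Phi>(1) \<open>\<Phi> \<in> B\<close> by simp
      ultimately have "\<exists>\<Psi>. \<Psi> \<in> D \<and> \<Psi> \<in> {F. 1 < blinfun_apply F p} \<inter> B" by (metis in_closure_of)
      then show ?thesis by blast
    qed
    obtain \<Psi> p q where *: "\<Psi> \<in> D" "p \<in> P" "q \<in> P" "p \<noteq> q" "1 < blinfun_apply \<Psi> p" "1 < blinfun_apply \<Psi> q"
      using uncountable_pigeonhole[where R = "\<lambda>p \<Psi>. 1 < blinfun_apply \<Psi> p", OF P(2) D(1) ex] by metis
    then have "\<Psi> \<in> B" using D(2) by blast
    then have "\<bar>\<Psi> ((1/2) *\<^sub>R (p + q))\<bar> \<le> 1" using mid[OF *(2-4)] B_iff by blast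
    then show False using *(5,6) by (simp add: blinfun.scaleR_right blinfun.add_right)
  qed
  ultimately show "\<exists>B::'b dual set. dual_ball B \<and> closedin weak_star B \<and> convex B \<and> \<not> weak_star_separable B"
    by blast

  define S where "S = {y. N y \<le> 1}"
  have "closed S"
  proof -
    have "\<bar>N x - N y\<bar> \<le> C * norm (x - y)" for x y
      using add[of "x - y" y] add[of "y - x" x] c(4)[of "x - y"] c(4)[of "y - x"]
      by (simp add: norm_minus_commute)
    then have "C-lipschitz_on UNIV N" using c(2)
      by (intro lipschitz_onI) (auto simp: dist_norm)
    then have "continuous_on UNIV N" by (rule lipschitz_on_continuous_on)
    then show ?thesis unfolding S_def by (intro closed_Collect_le continuous_on_const) auto
  qed
  moreover have "convex S"
  proof (rule convexI)
    fix x y and u v :: real assume xy: "x \<in> S" "y \<in> S" and uv: "0 \<le> u" "0 \<le> v" "u + v = 1"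
    have "N (u *\<^sub>R x + v *\<^sub>R y) \<le> u * N x + v * N y" using add[of "u *\<^sub>R x" "v *\<^sub>R y"] uv by (simp add: scale)
    also have "\<dots> \<le> u * 1 + v * 1" using xy uv by (intro add_mono mult_left_mono) (auto simp: S_def)
    finally show "u *\<^sub>R x + v *\<^sub>R y \<in> S" using uv by (simp add: S_def)
  qed
  moreover have "\<not> constructible S"
  proof
    assume "constructible S"
    then obtain \<H> where H: "countable \<H>" "\<And>H. H \<in> \<H> \<Longrightarrow> closed_half_space H" "S = \<Inter>\<H>"
      unfolding constructible_def by blast
    have ex: "\<exists>H\<in>\<H>. p \<notin> H" if "p \<in> P" for p
    proof -
      obtain \<Phi> :: "'b dual" where "1 < \<Phi> p" "\<bar>\<Phi> p\<bar> \<le> N p" using N(3)[OF \<open>p \<in> P\<close>] by blast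
      then have "p \<notin> S" by (simp add: S_def)
      then show ?thesis using H(3) by blast
    qed
    \<comment> \<open>One half-space omits two points of \<open>P\<close>. Its complement is convex
      and so contains their midpoint, which belongs to \<open>S\<close>.\<close>
    obtain H p q where *: "H \<in> \<H>" "p \<in> P" "q \<in> P" "p \<noteq> q" "p \<notin> H" "q \<notin> H"
      using uncountable_pigeonhole[where R = "\<lambda>p H. p \<notin> H", OF P(2) H(1) ex] by metis
    obtain f :: "'b dual" and \<alpha> where f: "H = {y. blinfun_apply f y \<le> \<alpha>}"
      using H(2)[OF *(1)] unfolding closed_half_space_def by blast
    have "(1/2) *\<^sub>R (p + q) \<in> H" using mid[OF *(2-4)] H(3) *(1) by (auto simp: S_def)
    then show False using *(5,6) f by (simp add: blinfun.scaleR_right blinfun.add_right)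
  qed
  ultimately show "\<exists>C::'b set. closed C \<and> convex C \<and> \<not> constructible C" by blast
qed

section \<open>Nonseparable spaces\<close>

text \<open>Coding a combination as a list, with repetitions allowed, reduces countability to that
  of a set of lists.\<close>

definition rational_combinations :: "'b::real_vector set \<Rightarrow> 'b set" where
  "rational_combinations F = (\<lambda>l. \<Sum>(q, f)\<leftarrow>l. of_rat q *\<^sub>R f) ` lists (UNIV \<times> F)"

lemma countable_rational_combinations: "countable F \<Longrightarrow> countable (rational_combinations F)"
  unfolding rational_combinations_def by (intro countable_image countable_lists countable_SIGMA) auto

lemma rational_combinations_mono: "F \<subseteq> G \<Longrightarrow> rational_combinations F \<subseteq> rational_combinations G"
  unfolding rational_combinations_def by (intro image_mono lists_mono Sigma_mono) auto

lemma rational_combinations_dense_in_span: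
  fixes x :: "'b::real_normed_vector"
  assumes "x \<in> span F" and "0 < e"
  shows "\<exists>c\<in>rational_combinations F. norm (x - c) < e"
proof -
  have "\<forall>e>0. \<exists>c\<in>rational_combinations F. norm (x - c) < e"
    using assms(1)
  proof (induction rule: span_induct_alt)
    case base
    have "0 \<in> rational_combinations F"
      unfolding rational_combinations_def by (rule image_eqI[of _ _ "[]"]) auto
    then show ?case by (auto intro!: bexI[of _ 0])
  next
    case (step a f y)
    show ?case
    proof (intro allI impI)
      fix e :: real assume e: "0 < e"
      obtain c where c: "c \<in> rational_combinations F" "norm (y - c) < e / 2"
        using step.IH e by (meson half_gt_zero)
      then obtain l where l: "l \<in> lists (UNIV \<times> F)" "c = (\<Sum>(q, f)\<leftarrow>l. of_rat q *\<^sub>R f)"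
        unfolding rational_combinations_def by blast
      \<comment> \<open>The summand one in \<open>norm f + 1\<close> covers \<open>f = 0\<close> and
        keeps the error from the coefficient within \<open>e / 2\<close>.\<close>
      obtain q where q: "a < of_rat q" "of_rat q < a + e / (2 * (norm f + 1))"
        using of_rat_dense[of a "a + e / (2 * (norm f + 1))"] e by (auto simp: add_nonneg_pos)
      have "\<bar>a - of_rat q\<bar> * norm f \<le> e / (2 * (norm f + 1)) * norm f"
        using q by (intro mult_right_mono) auto
      also have "\<dots> \<le> e / 2" using e by (simp add: field_simps add_pos_nonneg)
      finally have "norm ((a - of_rat q) *\<^sub>R f) \<le> e / 2" by simp
      then have "norm ((a - of_rat q) *\<^sub>R f + (y - c)) < e"
        using norm_triangle_ineq[of "(a - of_rat q) *\<^sub>R f" "y - c"] c(2) by linarith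
      moreover have "(a - of_rat q) *\<^sub>R f + (y - c) = a *\<^sub>R f + y - (of_rat q *\<^sub>R f + c)"
        by (simp add: algebra_simps)
      moreover have "of_rat q *\<^sub>R f + c \<in> rational_combinations F"
        unfolding rational_combinations_def
        by (rule image_eqI[of _ _ "(q, f) # l"]) (use l step.hyps in auto)
      ultimately show "\<exists>c\<in>rational_combinations F. norm (a *\<^sub>R f + y - c) < e" by metis
    qed
  qed
  then show ?thesis using assms(2) by blast
qed

text \<open>The closed span of a countable set is separable, hence proper here, and a point at
  positive distance from it yields the functional.\<close>

lemma annihilator_of_countable:
  fixes Z :: "'a::real_normed_vector set"
  assumes nonsep: "\<nexists>D::'a set. countable D \<and> closure D = UNIV" and Z: "countable Z"
  shows "\<exists>f::'a dual. norm f = 1 \<and> (\<forall>z\<in>Z. blinfun_apply f z = 0)"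
proof -
  have "closure (rational_combinations Z) \<noteq> UNIV" using nonsep Z countable_rational_combinations by blast
  then obtain x where "x \<notin> closure (rational_combinations Z)" by blast
  then obtain e where e: "0 < e" "\<And>c. c \<in> rational_combinations Z \<Longrightarrow> e \<le> norm (x - c)"
    unfolding closure_approachable by (auto simp: dist_norm norm_minus_commute not_less)
  have "e / 2 \<le> norm (x - v)" if "v \<in> span Z" for v
  proof -
    have "0 < e / 2" using e(1) by simp
    then obtain c where "c \<in> rational_combinations Z" "norm (v - c) < e / 2"
      using rational_combinations_dense_in_span[OF \<open>v \<in> span Z\<close>] by blast
    then show ?thesis using e(2)[of c] norm_triangle_ineq[of "x - v" "v - c"] by simp
  qed
  then obtain F :: "'a dual" where F: "\<And>v. v \<in> span Z \<Longrightarrow> F v = 0" "e / 2 \<le> F x"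
    using hahn_banach_dist[OF subspace_span, of Z "e / 2" x] by metis
  then have "F \<noteq> 0" using e(1) by auto
  then show ?thesis using F(1)
    by (intro exI[of _ "inverse (norm F) *\<^sub>R F"]) (auto simp: blinfun.scaleR_left span_base)
qed

section \<open>An uncountable well-order with countable initial segments\<close>

lemma countable_iff_card_le_natLeq:
  includes cardinal_syntax
  shows "countable A \<longleftrightarrow> |A| \<le>o natLeq"
proof -
  have "countable A \<longleftrightarrow> |A| \<le>o |UNIV :: nat set|"
    unfolding countable_def card_of_ordLeq[symmetric] by simp
  also have "\<dots> \<longleftrightarrow> |A| \<le>o natLeq"
    using card_of_nat ordLeq_ordIso_trans ordIso_symmetric by blast
  finally show ?thesis .
qed

text \<open>This is the first uncountable ordinal, taken as the cardinal successor of
  \<open>natLeq\<close>; that construction lives on the type \<open>nat set\<close>.\<close>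

lemma uncountable_wellorder_countable_segments:
  includes cardinal_syntax
  obtains r :: "nat set rel" where "Well_order r" "uncountable (Field r)"
    "\<And>a. a \<in> Field r \<Longrightarrow> countable (underS r a)"
proof -
  define r where "r = cardSuc natLeq"
  have c: "Card_order r" unfolding r_def by (rule cardSuc_Card_order[OF natLeq_Card_order])
  have "Well_order r" using c by (simp add: card_order_on_def)
  moreover have "uncountable (Field r)"
  proof
    assume "countable (Field r)"
    then have "|Field r| \<le>o natLeq" by (simp add: countable_iff_card_le_natLeq)
    then have "r \<le>o natLeq" using card_of_Field_ordIso[OF c] ordIso_ordLeq_trans ordIso_symmetric by blast
    moreover have "natLeq <o r" unfolding r_def by (rule cardSuc_greater[OF natLeq_Card_order])
    ultimately show False using not_ordLess_ordLeq by blast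
  qed
  moreover have "countable (underS r a)" if "a \<in> Field r" for a
  proof -
    have "|underS r a| <o cardSuc natLeq" using card_of_underS[OF c that] by (simp add: r_def)
    then have "|underS r a| \<le>o natLeq"
      using cardSuc_ordLeq_ordLess[OF natLeq_Card_order card_of_Card_order] by blast
    then show ?thesis by (simp add: countable_iff_card_le_natLeq)
  qed
  ultimately show thesis by (rule that)
qed

theorem almost_biorthogonal_of_nonseparable:
  assumes nonsep: "\<nexists>D::'a::real_normed_vector set. countable D \<and> closure D = UNIV"
  shows "\<exists>P::'a dual set. uncountable P \<and> almost_biorthogonal P"
proof -
  have "\<exists>x. norm x \<le> 1 \<and> norm c - inverse (real (Suc n)) < blinfun_apply c x" for c :: "'a dual" and n
    using exists_nearly_norming[of "norm c - inverse (real (Suc n))" c] by fastforce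
  then obtain w where w: "\<And>c n. norm (w c n) \<le> 1"
    "\<And>(c::'a dual) n. norm c - inverse (real (Suc n)) < blinfun_apply c (w c n)" by metis
  \<comment> \<open>For countable \<open>F\<close> this is a countable set norming the span of
    \<open>F\<close>: the points \<open>w c n\<close> norm each rational combination
    \<open>c\<close> up to \<open>inverse (Suc n)\<close>.\<close>
  define Z where "Z = (\<lambda>F. \<Union>c\<in>rational_combinations F. range (w c))"
  have Z_countable: "countable (Z F)" if "countable F" for F
    unfolding Z_def using countable_rational_combinations[OF that] by auto
  have Z_mono: "Z F \<subseteq> Z G" if "F \<subseteq> G" for F G
    unfolding Z_def using rational_combinations_mono[OF that] by blast
  \<comment> \<open>The points of \<open>Z F\<close> do not see \<open>h\<close>, so adding
    \<open>h\<close> cannot shrink the norm of \<open>u\<close>.\<close>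
  have Z_norming: "norm u \<le> norm (u + h)" if u: "u \<in> span F" and h: "\<And>z. z \<in> Z F \<Longrightarrow> blinfun_apply h z = 0" for u h F
  proof (rule field_le_epsilon)
    fix e :: real assume e: "0 < e"
    then obtain c where c: "c \<in> rational_combinations F" "norm (u - c) < e / 3"
      using rational_combinations_dense_in_span[OF u, of "e / 3"] by auto
    obtain n where n: "inverse (real (Suc n)) < e / 3" using reals_Archimedean[of "e / 3"] e by auto
    let ?z = "w c n"
    have z1: "norm (v ?z) \<le> norm v" for v :: "'a dual"
      using norm_blinfun[of v ?z] mult_left_mono[OF w(1)[of c n] norm_ge_zero[of v]] by simp
    have "norm u \<le> norm c + e / 3" using c(2) norm_triangle_ineq2[of u c] by simp
    also have "\<dots> \<le> c ?z + 2 * e / 3" using w(2)[of c n] n by simp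
    also have "c ?z \<le> u ?z + e / 3"
      using z1[of "u - c"] c(2) by (simp add: blinfun.diff_left)
    also have "u ?z = (u + h) ?z" using h[of ?z] c(1) by (auto simp: Z_def blinfun.add_left)
    also have "\<dots> \<le> norm (u + h)" using z1[of "u + h"] by simp
    finally show "norm u \<le> norm (u + h) + e" by simp
  qed
  obtain r :: "nat set rel" where r: "Well_order r" "uncountable (Field r)"
    "\<And>a. a \<in> Field r \<Longrightarrow> countable (underS r a)"
    using uncountable_wellorder_countable_segments by blast
  have wf: "wf (r - Id)" using r(1) by (simp add: well_order_on_def)
  define nxt where "nxt = (\<lambda>F. SOME f::'a dual. norm f = 1 \<and> (\<forall>z\<in>Z F. blinfun_apply f z = 0))"
  have nxt: "norm (nxt F) = 1" "\<And>z. z \<in> Z F \<Longrightarrow> nxt F z = 0" if "countable F" for F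
    using someI_ex[OF annihilator_of_countable[OF nonsep Z_countable[OF that]]] unfolding nxt_def by auto
  \<comment> \<open>Transfinite recursion along the strict part of \<open>r\<close>, where each
    value depends only on the set of earlier values.\<close>
  define f where "f = wfrec (r - Id) (\<lambda>f a. nxt (f ` underS r a))"
  have f_rec: "f a = nxt (f ` underS r a)" for a
  proof -
    have "cut f (r - Id) a ` underS r a = f ` underS r a"
      by (rule image_cong) (auto simp: cut_def underS_def)
    then show ?thesis unfolding f_def by (subst wfrec[OF wf]) simp
  qed
  have f: "norm (f a) = 1" "\<And>z. z \<in> Z (f ` underS r a) \<Longrightarrow> f a z = 0" if "a \<in> Field r" for a
    using nxt[of "f ` underS r a"] r(3)[OF that] f_rec[of a] by auto
  \<comment> \<open>Split \<open>v = s + h\<close> into earlier and later parts. The later part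
    vanishes on points norming the span of \<open>f a\<close> and the earlier values, so dropping
    \<open>h\<close> does not increase the distance. Since \<open>f a\<close> vanishes on points
    norming the earlier span, \<open>norm s \<le> norm (f a - s)\<close>, whence
    \<open>1 \<le> 2 * norm (f a - s)\<close>.\<close>
  have dist: "1/2 \<le> norm (f a - v)" if a: "a \<in> Field r" and v: "v \<in> span (f ` (Field r - {a}))" for a v
  proof -
    define A where "A = f ` underS r a"
    define B where "B = f ` {b \<in> Field r. a \<in> underS r b}"
    have "b \<in> underS r a \<or> a \<in> underS r b" if "b \<in> Field r - {a}" for b
      using that a r(1) unfolding well_order_on_def linear_order_on_def total_on_def underS_def by blast
    then have "f ` (Field r - {a}) \<subseteq> A \<union> B" by (auto simp: A_def B_def)
    then have "v \<in> span (A \<union> B)" using v span_mono by blast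
    then obtain s h where sh: "s \<in> span A" "h \<in> span B" "v = s + h" unfolding span_Un by blast
    have trans: "trans r" using r(1) by (simp add: order_on_defs)
    have anti: "antisym r" using r(1) by (simp add: order_on_defs)
    have vanish: "h z = 0" if z: "z \<in> Z (insert (f a) A)" for z
      using sh(2)
    proof (induction rule: span_induct_alt)
      case (step c g y)
      then obtain b where b: "b \<in> Field r" "a \<in> underS r b" "g = f b" by (auto simp: B_def)
      have "underS r a \<subseteq> underS r b" using b(2) trans anti unfolding underS_def
        by (auto dest: transD antisymD)
      then have "insert (f a) A \<subseteq> f ` underS r b" using b(2) by (auto simp: A_def)
      then have "g z = 0" using f(2)[OF b(1)] b(3) z Z_mono by blast
      then show ?case using step.IH by (simp add: blinfun.add_left blinfun.scaleR_left)
    qed simp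
    have "s \<in> span (insert (f a) A)" using sh(1) span_mono[of A "insert (f a) A"] by blast
    moreover have "f a \<in> span (insert (f a) A)" by (rule span_base) simp
    ultimately have "f a - s \<in> span (insert (f a) A)" by (intro span_diff)
    then have 1: "norm (f a - s) \<le> norm (f a - s + - h)"
      using vanish by (intro Z_norming) (auto simp: blinfun.minus_left)
    have "norm (- s) \<le> norm (- s + f a)"
      using sh(1) f(2)[OF a] by (intro Z_norming[of _ A]) (auto simp: A_def span_neg)
    moreover have "norm (f a) \<le> norm (f a - s) + norm s" using norm_triangle_ineq[of "f a - s" s] by simp
    ultimately have "1 \<le> 2 * norm (f a - s)" using f(1)[OF a] by simp
    then show ?thesis using 1 sh(3) by (simp add: algebra_simps)
  qed
  have "inj_on f (Field r)"
  proof (rule inj_onI, rule ccontr)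
    fix a b assume ab: "a \<in> Field r" "b \<in> Field r" "f a = f b" "a \<noteq> b"
    then have "f a \<in> span (f ` (Field r - {a}))" by (intro span_base) auto
    then show False using dist[OF ab(1)] by fastforce
  qed
  then have "uncountable (f ` Field r)" using r(2) countable_image_inj_on by blast
  moreover have "almost_biorthogonal (f ` Field r)"
  proof (rule almost_biorthogonalI[where a = "1/2" and K = 1])
    show "bounded (f ` Field r)" using f(1) by (auto simp: bounded_iff intro!: exI[of _ 1])
    fix p assume "p \<in> f ` Field r"
    then obtain a where a: "a \<in> Field r" "p = f a" by blast
    obtain \<Psi> :: "'a dual dual" where \<Psi>: "norm \<Psi> \<le> 1" "\<And>v. v \<in> span (f ` (Field r - {a})) \<Longrightarrow> \<Psi> v = 0"
      "1/2 \<le> \<Psi> (f a)"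
      using hahn_banach_dist[OF subspace_span dist[OF a(1)]] by metis
    have "\<Psi> q = 0" if q: "q \<in> f ` Field r - {p}" for q
    proof -
      have "q \<in> f ` (Field r - {a})" using q a(2) by auto
      then show ?thesis by (intro \<Psi>(2) span_base)
    qed
    then show "\<exists>\<Phi>::'a dual dual. norm \<Phi> \<le> 1 \<and> 1/2 \<le> blinfun_apply \<Phi> p \<and>
      (\<forall>q\<in>f ` Field r - {p}. \<bar>blinfun_apply \<Phi> q\<bar> \<le> 1/2/2)" using \<Psi> a(2) by (intro exI[of _ \<Psi>]) auto
  qed simp
  ultimately show ?thesis by blast
qed

section \<open>Separable spaces with nonseparable dual\<close>

text \<open>Separability at the single scale \<open>e\<close>. The coverable sets form a
  \<sigma>-ideal, and sets outside it count as large.\<close>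

definition coverable :: "real \<Rightarrow> 'b::real_normed_vector set \<Rightarrow> bool" where
  "coverable e U \<longleftrightarrow> (\<exists>C. countable C \<and> (\<forall>f\<in>U. \<exists>c\<in>C. norm (f - c) < e))"

lemma coverable_subset: "coverable e V \<Longrightarrow> U \<subseteq> V \<Longrightarrow> coverable e U"
  unfolding coverable_def by (meson subsetD)

lemma coverable_UN:
  assumes "countable I" and "\<And>i. i \<in> I \<Longrightarrow> coverable e (U i)"
  shows "coverable e (\<Union>i\<in>I. U i)"
proof -
  from assms(2) obtain C where C: "\<And>i. i \<in> I \<Longrightarrow> countable (C i)"
    "\<And>i f. i \<in> I \<Longrightarrow> f \<in> U i \<Longrightarrow> \<exists>c\<in>C i. norm (f - c) < e"
    unfolding coverable_def by metis
  have "countable (\<Union>i\<in>I. C i)" using assms(1) C(1) by (rule countable_UN)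
  moreover have "\<forall>f\<in>\<Union>i\<in>I. U i. \<exists>c\<in>\<Union>i\<in>I. C i. norm (f - c) < e" using C(2) by blast
  ultimately show ?thesis unfolding coverable_def by blast
qed

lemma coverable_Un:
  assumes "coverable e U" "coverable e V"
  shows "coverable e (U \<union> V)"
proof -
  have "coverable e (\<Union>A\<in>{U, V}. A)" by (rule coverable_UN) (use assms in auto)
  then show ?thesis by simp
qed

text \<open>If every ball were coverable at every scale, the centres for the scales
  \<open>inverse (Suc n)\<close> would together form a countable dense set.\<close>

lemma not_coverable_ball:
  assumes "\<nexists>D::'b::real_normed_vector set. countable D \<and> closure D = UNIV"
  shows "\<exists>e>0. \<exists>M>0. \<not> coverable e (cball (0::'b) M)"
proof (rule ccontr)
  assume "\<not> ?thesis"
  then have cov: "coverable e (cball (0::'b) M)" if "0 < e" "0 < M" for e M using that by blast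
  have "coverable e (UNIV :: 'b set)" if "0 < e" for e
  proof -
    have "coverable e (\<Union>n::nat. cball (0::'b) (real (Suc n)))"
      using cov that by (intro coverable_UN) auto
    moreover have "(\<Union>n::nat. cball (0::'b) (real (Suc n))) = UNIV"
    proof -
      have "\<exists>n. norm x \<le> real (Suc n)" for x :: 'b
        using real_arch_simple[of "norm x"] by (metis le_SucI of_nat_le_iff order_refl order_trans)
      then show ?thesis by auto
    qed
    ultimately show ?thesis by simp
  qed
  then have "coverable (inverse (real (Suc n))) (UNIV :: 'b set)" for n by simp
  then obtain C :: "nat \<Rightarrow> 'b set" where C: "\<And>n. countable (C n)"
    "\<And>n f. \<exists>c\<in>C n. norm (f - c) < inverse (real (Suc n))"
    unfolding coverable_def by (metis UNIV_I)
  have "closure (\<Union>n. C n) = UNIV"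
  proof -
    have "f \<in> closure (\<Union>n. C n)" for f
      unfolding closure_approachable
    proof (intro allI impI)
      fix e :: real assume "0 < e"
      then obtain n where n: "inverse (real (Suc n)) < e" using reals_Archimedean by blast
      obtain c where "c \<in> C n" "norm (f - c) < inverse (real (Suc n))" using C(2) by blast
      then show "\<exists>y\<in>\<Union>n. C n. dist y f < e"
        using n by (auto simp: dist_norm norm_minus_commute intro!: exI[of _ n] bexI[of _ c])
    qed
    then show ?thesis by blast
  qed
  moreover have "countable (\<Union>n. C n)" using C(1) by auto
  ultimately show False using assms by blast
qed

text \<open>Subbasic weak-star neighbourhoods, given by a single \<open>x\<close>, suffice because
  each refinement tests the functionals at one point only.\<close>

definition condensation_points :: "real \<Rightarrow> 'a::real_normed_vector dual set \<Rightarrow> 'a dual set" where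
  "condensation_points e U =
     {f \<in> U. \<forall>x d. 0 < d \<longrightarrow> \<not> coverable e {g \<in> U. \<bar>blinfun_apply g x - blinfun_apply f x\<bar> < d}}"

text \<open>A Lindelof argument: each discarded point lies in a coverable strip given by a point of
  \<open>D\<close> and rational bounds. There are countably many such strips, so only a coverable
  set is discarded.\<close>

lemma not_coverable_condensation_points:
  fixes U :: "'a::real_normed_vector dual set"
  assumes D: "countable D" "closure D = (UNIV :: 'a set)"
    and U: "\<not> coverable e U" "\<And>f. f \<in> U \<Longrightarrow> norm f \<le> M" and M: "0 < M"
  shows "\<not> coverable e (condensation_points e U)"
proof
  define S where "S = (\<lambda>(y, a, b). {g \<in> U. of_rat a < blinfun_apply g y \<and> blinfun_apply g y < of_rat b})"
  define I where "I = {i \<in> D \<times> UNIV \<times> UNIV. coverable e (S i)}"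
  assume *: "coverable e (condensation_points e U)"
  have "countable (D \<times> (UNIV :: rat set) \<times> (UNIV :: rat set))" using D(1) by auto
  then have "countable I" unfolding I_def by (rule countable_subset[rotated]) auto
  then have "coverable e (\<Union>i\<in>I. S i)" by (rule coverable_UN) (simp add: I_def)
  moreover have "U \<subseteq> condensation_points e U \<union> (\<Union>i\<in>I. S i)"
  proof
    fix f assume f: "f \<in> U"
    show "f \<in> condensation_points e U \<union> (\<Union>i\<in>I. S i)"
    proof (cases "f \<in> condensation_points e U")
      case False
      then obtain x d where d: "0 < d" "coverable e {g \<in> U. \<bar>blinfun_apply g x - blinfun_apply f x\<bar> < d}"
        using f unfolding condensation_points_def by blast
      \<comment> \<open>Since \<open>U\<close> is bounded by \<open>M\<close>, replacing
        \<open>x\<close> by \<open>y\<close> changes each value by at most \<open>d / 4\<close>. Two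
        such changes and a strip within \<open>d / 2\<close> of \<open>f y\<close> stay below
        \<open>d\<close>.\<close>
      have "x \<in> closure D" "0 < d / (4 * M)" using D(2) d(1) M by auto
      then obtain y where y: "y \<in> D" "norm (x - y) < d / (4 * M)"
        unfolding closure_approachable by (metis dist_norm dist_commute)
      then have "M * norm (x - y) \<le> d / 4" using M by (simp add: field_simps)
      then have near: "\<bar>g x - g y\<bar> \<le> d / 4" if "g \<in> U" for g
        using norm_blinfun[of g "x - y"] mult_right_mono[OF U(2)[OF that] norm_ge_zero[of "x - y"]]
        by (simp add: blinfun.diff_right)
      obtain a where a: "f y - d / 2 < of_rat a" "of_rat a < f y"
        using of_rat_dense[of "f y - d / 2" "f y"] d(1) by auto
      obtain b where b: "f y < of_rat b" "of_rat b < f y + d / 2"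
        using of_rat_dense[of "f y" "f y + d / 2"] d(1) by auto
      have "S (y, a, b) \<subseteq> {g \<in> U. \<bar>blinfun_apply g x - blinfun_apply f x\<bar> < d}"
      proof
        fix g assume g: "g \<in> S (y, a, b)"
        then have gU: "g \<in> U" and gy: "of_rat a < g y" "g y < of_rat b" by (auto simp: S_def)
        then have "\<bar>g y - f y\<bar> < d / 2" using a b by linarith
        then have "\<bar>g x - f x\<bar> < d" using near[OF gU] near[OF f] by linarith
        then show "g \<in> {g \<in> U. \<bar>blinfun_apply g x - blinfun_apply f x\<bar> < d}" using gU by simp
      qed
      then have "(y, a, b) \<in> I" using y(1) coverable_subset[OF d(2)] by (simp add: I_def)
      moreover have "f \<in> S (y, a, b)" using f a b by (simp add: S_def)
      ultimately show ?thesis by blast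
    qed simp
  qed
  ultimately show False using U(1) coverable_subset coverable_Un[OF *] by blast
qed

text \<open>If the kernels of \<open>G\<close> do not already force \<open>g\<close> to vanish, some
  \<open>y\<close> in their intersection has \<open>g y \<noteq> 0\<close>. Subtracting the multiple
  of \<open>g\<close> that agrees with \<open>h\<close> at \<open>y\<close> reduces the claim to
  \<open>G\<close>.\<close>

lemma in_span_of_common_kernel:
  fixes G :: "'a::real_normed_vector dual set" and h :: "'a dual"
  assumes "finite G" and "\<And>x. \<forall>g\<in>G. blinfun_apply g x = 0 \<Longrightarrow> h x = 0"
  shows "h \<in> span G"
  using assms
proof (induction G arbitrary: h rule: finite_induct)
  case empty
  then have "h = 0" by (intro blinfun_eqI) simp
  then show ?case by simp
next
  case (insert g G)
  show ?case
  proof (cases "\<forall>x. (\<forall>k\<in>G. blinfun_apply k x = 0) \<longrightarrow> g x = 0")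
    case True
    then have "h \<in> span G" using insert.prems by (intro insert.IH) auto
    then show ?thesis using span_mono[of G "insert g G"] by blast
  next
    case False
    then obtain y where y: "\<And>k. k \<in> G \<Longrightarrow> blinfun_apply k y = 0" "g y \<noteq> 0" by blast
    define c where "c = h y / g y"
    have "h - c *\<^sub>R g \<in> span G"
    proof (rule insert.IH)
      fix x assume x: "\<forall>k\<in>G. blinfun_apply k x = 0"
      define z where "z = x - (g x / g y) *\<^sub>R y"
      have "h z = 0" using x y by (intro insert.prems) (auto simp: z_def blinfun.diff_right blinfun.scaleR_right)
      then show "blinfun_apply (h - c *\<^sub>R g) x = 0"
        by (simp add: z_def c_def blinfun.diff_right blinfun.scaleR_right blinfun.diff_left blinfun.scaleR_left)
    qed
    then have "h - c *\<^sub>R g \<in> span (insert g G)" using span_mono[of G "insert g G"] by blast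
    moreover have "c *\<^sub>R g \<in> span (insert g G)" by (intro span_scale span_base) simp
    ultimately have "(h - c *\<^sub>R g) + c *\<^sub>R g \<in> span (insert g G)" by (rule span_add)
    then show ?thesis by simp
  qed
qed

text \<open>If \<open>f\<close> were bounded by \<open>e / 2\<close> on the common kernel, an
  extension of that restriction with the same bound would differ from \<open>f\<close> by an element
  of \<open>span G\<close>, too close to \<open>f\<close>. The factor 2 pays for an infimum that
  need not be attained.\<close>

lemma helly_biorthogonal:
  fixes G :: "'a::real_normed_vector dual set" and f :: "'a dual"
  assumes G: "finite G" and e: "0 < e" and dist: "\<And>v. v \<in> span G \<Longrightarrow> e \<le> norm (f - v)"
  obtains x where "norm x \<le> 2 / e" and "f x = 1" and "\<And>g. g \<in> G \<Longrightarrow> blinfun_apply g x = 0"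
proof -
  define N where "N = {x. \<forall>g\<in>G. blinfun_apply g x = 0}"
  have N: "subspace N" by (auto simp: N_def subspace_def blinfun.add_right blinfun.scaleR_right)
  have "\<exists>x\<in>N. e / 2 * norm x < f x"
  proof (rule ccontr)
    assume "\<not> ?thesis"
    then have le: "f x \<le> e / 2 * norm x" if "x \<in> N" for x using that by force
    obtain F :: "'a dual" where F: "norm F \<le> e / 2" "\<And>x. x \<in> N \<Longrightarrow> F x = f x"
    proof (rule hahn_banach_norm_extension[OF N, of "blinfun_apply f" "e / 2"])
    qed (use le e in \<open>auto simp: blinfun.add_right blinfun.scaleR_right\<close>)
    have "f - F \<in> span G"
      using F(2) by (intro in_span_of_common_kernel[OF G]) (simp add: N_def blinfun.diff_left)
    from dist[OF this] show False using F(1) e by simp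
  qed
  then obtain x where x: "x \<in> N" "e / 2 * norm x < f x" by blast
  have "0 \<le> e / 2 * norm x" using e by simp
  then have pos: "0 < f x" using x(2) by linarith
  show thesis
  proof (rule that[of "inverse (f x) *\<^sub>R x"])
    show "norm (inverse (f x) *\<^sub>R x) \<le> 2 / e" using x(2) pos e by (simp add: field_simps)
    show "f (inverse (f x) *\<^sub>R x) = 1" using pos by (simp add: blinfun.scaleR_right)
    show "blinfun_apply g (inverse (f x) *\<^sub>R x) = 0" if "g \<in> G" for g
      using x(1) that by (simp add: N_def blinfun.scaleR_right)
  qed
qed

text \<open>The functional in the \<open>s\<close>-th set is chosen last, far from the span of those chosen in the other
  sets.  So the bound on \<open>x\<close> does not depend on the number of sets.\<close>

lemma not_coverable_refine_one:
  fixes U :: "'i \<Rightarrow> 'a::real_normed_vector dual set"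
  assumes D: "countable D" "closure D = (UNIV :: 'a set)" and e: "0 < e" and M: "0 < M"
    and T: "finite T" "s \<in> T"
    and U: "\<And>t. t \<in> T \<Longrightarrow> \<not> coverable e (U t)" "\<And>t f. t \<in> T \<Longrightarrow> f \<in> U t \<Longrightarrow> norm f \<le> M"
  obtains x V where "norm x \<le> 4 / e"
    and "\<And>t. t \<in> T \<Longrightarrow> V t \<subseteq> U t" and "\<And>t. t \<in> T \<Longrightarrow> \<not> coverable e (V t)"
    and "\<And>t f. t \<in> T \<Longrightarrow> f \<in> V t \<Longrightarrow> \<bar>blinfun_apply f x - of_bool (t = s)\<bar> \<le> 1/4"
proof -
  have core: "\<not> coverable e (condensation_points e (U t))" if "t \<in> T" for t
    using not_coverable_condensation_points[OF D U(1)[OF that] U(2)[OF that] M] by blast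
  then have "\<exists>f. f \<in> condensation_points e (U t)" if "t \<in> T" for t
    using that unfolding coverable_def by (metis ex_in_conv countable_empty)
  then obtain p where p: "\<And>t. t \<in> T \<Longrightarrow> p t \<in> condensation_points e (U t)" by metis
  define G where "G = p ` (T - {s})"
  have "finite G" using T(1) by (simp add: G_def)
  then have "countable (rational_combinations G)"
    by (intro countable_rational_combinations countable_finite)
  \<comment> \<open>The condensation points are not covered by the balls of radius \<open>e\<close>
    around the countably many rational combinations of \<open>G\<close>. Passing to the whole span
    costs \<open>e / 2\<close>, whence the bound \<open>4 / e\<close>.\<close>
  then obtain q where q: "q \<in> condensation_points e (U s)"
    "\<And>c. c \<in> rational_combinations G \<Longrightarrow> e \<le> norm (q - c)"
    using core[OF T(2)] unfolding coverable_def by (metis not_less)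
  have "e / 2 \<le> norm (q - v)" if "v \<in> span G" for v
  proof -
    obtain c where "c \<in> rational_combinations G" "norm (v - c) < e / 2"
      using rational_combinations_dense_in_span[OF \<open>v \<in> span G\<close>, of "e / 2"] e by auto
    then show ?thesis using q(2)[of c] norm_triangle_ineq[of "q - v" "v - c"] by simp
  qed
  then obtain x where x: "norm x \<le> 2 / (e / 2)" "q x = 1" "\<And>g. g \<in> G \<Longrightarrow> blinfun_apply g x = 0"
    using helly_biorthogonal[OF \<open>finite G\<close>, of "e / 2" q] e by auto
  define p' where "p' = p(s := q)"
  have p': "p' t \<in> condensation_points e (U t)" "p' t x = of_bool (t = s)" if "t \<in> T" for t
    using p[OF that] q(1) x(2) x(3)[of "p t"] that by (auto simp: p'_def G_def)
  \<comment> \<open>Each \<open>V t\<close> is a weak-star neighbourhood of a condensation point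
    within \<open>U t\<close>, so it remains large.\<close>
  define V where "V = (\<lambda>t. {g \<in> U t. \<bar>blinfun_apply g x - blinfun_apply (p' t) x\<bar> < 1/4})"
  show thesis
  proof (rule that[of x V])
    show "norm x \<le> 4 / e" using x(1) by simp
    show "V t \<subseteq> U t" for t by (auto simp: V_def)
    show "\<not> coverable e (V t)" if "t \<in> T" for t
    proof -
      have "\<forall>d>0. \<not> coverable e {g \<in> U t. \<bar>blinfun_apply g x - blinfun_apply (p' t) x\<bar> < d}"
        using p'(1)[OF that] unfolding condensation_points_def by blast
      from this[rule_format, of "1/4"] show ?thesis by (simp add: V_def)
    qed
    show "\<bar>blinfun_apply f x - of_bool (t = s)\<bar> \<le> 1/4" if "t \<in> T" "f \<in> V t" for t f
      using that p'(2)[OF that(1)] by (simp add: V_def)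
  qed
qed

text \<open>The one-index refinement is applied to each \<open>s\<close> in turn; earlier bounds
  persist because the sets only shrink.\<close>

lemma not_coverable_refine:
  fixes U :: "'i \<Rightarrow> 'a::real_normed_vector dual set"
  assumes D: "countable D" "closure D = (UNIV :: 'a set)" and e: "0 < e" and M: "0 < M"
    and T: "finite T"
    and U: "\<And>t. t \<in> T \<Longrightarrow> \<not> coverable e (U t)" "\<And>t f. t \<in> T \<Longrightarrow> f \<in> U t \<Longrightarrow> norm f \<le> M"
  shows "\<exists>x V. \<forall>t\<in>T. norm (x t) \<le> 4 / e \<and> V t \<subseteq> U t \<and> \<not> coverable e (V t) \<and>
     (\<forall>s\<in>T. \<forall>f\<in>V t. \<bar>blinfun_apply f (x s) - of_bool (t = s)\<bar> \<le> 1/4)"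
proof -
  have "\<exists>x V. (\<forall>s\<in>S. norm (x s) \<le> 4 / e) \<and> (\<forall>t\<in>T. V t \<subseteq> U t \<and> \<not> coverable e (V t) \<and>
     (\<forall>s\<in>S. \<forall>f\<in>V t. \<bar>blinfun_apply f (x s) - of_bool (t = s)\<bar> \<le> 1/4))" if "finite S" "S \<subseteq> T" for S
    using that
  proof (induction S rule: finite_induct)
    case empty
    show ?case using U(1) by (intro exI[of _ "\<lambda>_. 0"] exI[of _ U]) auto
  next
    case (insert s S)
    then obtain x V where *: "(\<forall>s\<in>S. norm (x s) \<le> 4 / e) \<and> (\<forall>t\<in>T. V t \<subseteq> U t \<and> \<not> coverable e (V t) \<and>
     (\<forall>s\<in>S. \<forall>f\<in>V t. \<bar>blinfun_apply f (x s) - of_bool (t = s)\<bar> \<le> 1/4))" by blast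
    then have xV: "\<And>r. r \<in> S \<Longrightarrow> norm (x r) \<le> 4 / e" "\<And>t. t \<in> T \<Longrightarrow> V t \<subseteq> U t"
      "\<And>t. t \<in> T \<Longrightarrow> \<not> coverable e (V t)"
      "\<And>t r f. t \<in> T \<Longrightarrow> r \<in> S \<Longrightarrow> f \<in> V t \<Longrightarrow> \<bar>blinfun_apply f (x r) - of_bool (t = r)\<bar> \<le> 1/4"
      by blast+
    have V: "norm f \<le> M" if "t \<in> T" "f \<in> V t" for t f using U(2) xV(2) that by blast
    have "s \<in> T" using insert.prems by simp
    obtain y W where yW: "norm y \<le> 4 / e" "\<And>t. t \<in> T \<Longrightarrow> W t \<subseteq> V t"
      "\<And>t. t \<in> T \<Longrightarrow> \<not> coverable e (W t)"
      "\<And>t f. t \<in> T \<Longrightarrow> f \<in> W t \<Longrightarrow> \<bar>blinfun_apply f y - of_bool (t = s)\<bar> \<le> 1/4"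
      by (rule not_coverable_refine_one[where U = V, OF D e M T \<open>s \<in> T\<close> xV(3) V]) blast+
    show ?case
    proof (intro exI[of _ "x(s := y)"] exI[of _ W] conjI ballI)
      show "norm ((x(s := y)) r) \<le> 4 / e" if "r \<in> insert s S" for r using that xV(1) yW(1) by auto
      show "W t \<subseteq> U t" if "t \<in> T" for t using xV(2) yW(2) that by blast
      show "\<not> coverable e (W t)" if "t \<in> T" for t using yW(3) that .
      show "\<bar>blinfun_apply f ((x(s := y)) r) - of_bool (t = r)\<bar> \<le> 1/4"
        if "t \<in> T" "r \<in> insert s S" "f \<in> W t" for t r f
        using that xV(4)[of t r f] yW(2)[of t] yW(4)[of t f] by (cases "r = s") auto
    qed
  qed
  from this[OF T order_refl] show ?thesis by blast
qed

text \<open>Whole levels are chosen successively: every node of the next level starts from its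
  parent's set, and one refinement separates all of them. The bound on the test points does not
  depend on the level.\<close>

lemma not_coverable_tree:
  fixes D :: "'a::real_normed_vector set"
  assumes D: "countable D" "closure D = UNIV" and e: "0 < e" and M: "0 < M"
    and ball: "\<not> coverable e (cball (0 :: 'a dual) M)"
  obtains W :: "bool list \<Rightarrow> 'a dual set" and x where
    "\<And>t. W t \<noteq> {}" and "\<And>t f. f \<in> W t \<Longrightarrow> norm f \<le> M" and "\<And>t b. W (t @ [b]) \<subseteq> W t"
    and "\<And>t. norm (x t) \<le> 4 / e"
    and "\<And>s t f. length s = length t \<Longrightarrow> t \<noteq> [] \<Longrightarrow> f \<in> W t \<Longrightarrow> \<bar>blinfun_apply f (x s) - of_bool (t = s)\<bar> \<le> 1/4"
proof -
  define T where "T = (\<lambda>n. {t :: bool list. length t = n})"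
  have T: "finite (T n)" for n using finite_lists_length_eq[of "UNIV :: bool set" n] by (simp add: T_def)
  define P where "P = (\<lambda>n U. \<forall>t\<in>T n. \<not> coverable e (U t) \<and> (\<forall>f\<in>U t. norm (f :: 'a dual) \<le> M))"
  define Q where "Q = (\<lambda>n (U :: bool list \<Rightarrow> 'a dual set) V. \<exists>x. \<forall>t\<in>T (Suc n). norm (x t) \<le> 4 / e \<and> V t \<subseteq> U (butlast t) \<and>
     (\<forall>s\<in>T (Suc n). \<forall>f\<in>V t. \<bar>blinfun_apply f (x s) - of_bool (t = s)\<bar> \<le> 1/4))"
  have "\<exists>U. \<forall>n. P n (U n) \<and> Q n (U n) (U (Suc n))"
  proof (rule dependent_nat_choice)
    show "\<exists>U. P 0 U" using ball by (intro exI[of _ "\<lambda>_. cball 0 M"]) (simp add: P_def)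
    fix U n assume U: "P n U"
    have "butlast t \<in> T n" if "t \<in> T (Suc n)" for t using that by (simp add: T_def)
    then have U': "\<And>t. t \<in> T (Suc n) \<Longrightarrow> \<not> coverable e (U (butlast t))"
      "\<And>t f. t \<in> T (Suc n) \<Longrightarrow> f \<in> U (butlast t) \<Longrightarrow> norm f \<le> M" using U by (auto simp: P_def)
    have "\<exists>x V. \<forall>t\<in>T (Suc n). norm (x t) \<le> 4 / e \<and> V t \<subseteq> U (butlast t) \<and> \<not> coverable e (V t) \<and>
     (\<forall>s\<in>T (Suc n). \<forall>f\<in>V t. \<bar>blinfun_apply f (x s) - of_bool (t = s)\<bar> \<le> 1/4)"
      by (rule not_coverable_refine[where U = "\<lambda>t. U (butlast t)", OF D e M T[of "Suc n"]]) (use U' in blast)+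
    then obtain x V where V: "\<forall>t\<in>T (Suc n). norm (x t) \<le> 4 / e \<and> V t \<subseteq> U (butlast t) \<and> \<not> coverable e (V t) \<and>
     (\<forall>s\<in>T (Suc n). \<forall>f\<in>V t. \<bar>blinfun_apply f (x s) - of_bool (t = s)\<bar> \<le> 1/4)" by blast
    then have "P (Suc n) V" using U'(2) unfolding P_def by blast
    moreover have "Q n U V" using V unfolding Q_def by blast
    ultimately show "\<exists>V. P (Suc n) V \<and> Q n U V" by blast
  qed
  then obtain U where U: "\<And>n. P n (U n)" "\<And>n. Q n (U n) (U (Suc n))" by blast
  from U(2) obtain y where y: "\<And>n t. t \<in> T (Suc n) \<Longrightarrow> norm (y n t) \<le> 4 / e"
    "\<And>n t. t \<in> T (Suc n) \<Longrightarrow> U (Suc n) t \<subseteq> U n (butlast t)"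
    "\<And>n t s f. t \<in> T (Suc n) \<Longrightarrow> s \<in> T (Suc n) \<Longrightarrow> f \<in> U (Suc n) t \<Longrightarrow> \<bar>blinfun_apply f (y n s) - of_bool (t = s)\<bar> \<le> 1/4"
    unfolding Q_def by metis
  show thesis
  \<comment> \<open>The passage from level \<open>n\<close> to \<open>Suc n\<close> produces
    \<open>y n\<close>, hence the shift by one. The root has no test point and receives 0.\<close>
  proof (rule that[of "\<lambda>t. U (length t) t" "\<lambda>t. if t = [] then 0 else y (length t - 1) t"])
    have "coverable e ({} :: 'a dual set)" by (auto simp: coverable_def)
    then show "U (length t) t \<noteq> {}" for t using U(1)[of "length t"] by (auto simp: P_def T_def)
    show "norm f \<le> M" if "f \<in> U (length t) t" for t f
      using U(1)[of "length t"] that by (auto simp: P_def T_def)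
    show "U (length (t @ [b])) (t @ [b]) \<subseteq> U (length t) t" for t b
      using y(2)[of "t @ [b]" "length t"] by (simp add: T_def)
    show "norm (if t = [] then 0 else y (length t - 1) t) \<le> 4 / e" for t
      using y(1)[of t "length t - 1"] e by (simp add: T_def)
    show "\<bar>blinfun_apply f (if s = [] then 0 else y (length s - 1) s) - of_bool (t = s)\<bar> \<le> 1/4"
      if "length s = length t" "t \<noteq> []" "f \<in> U (length t) t" for s t f
    proof -
      obtain n where n: "length t = Suc n" using \<open>t \<noteq> []\<close> by (cases t) auto
      then have s: "length s = Suc n" "s \<noteq> []" using \<open>length s = length t\<close> by auto
      have "f \<in> U (Suc n) t" using \<open>f \<in> U (length t) t\<close> n by simp
      then have "\<bar>blinfun_apply f (y n s) - of_bool (t = s)\<bar> \<le> 1/4" using n s by (intro y(3)) (auto simp: T_def)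
      then show ?thesis using s by simp
    qed
  qed
qed

section \<open>Cluster points along the branches of the tree\<close>

definition evaluation :: "'a::real_normed_vector \<Rightarrow> 'a dual dual" where
  "evaluation x = Blinfun (\<lambda>f. blinfun_apply f x)"

lemma evaluation_apply: "blinfun_apply (evaluation x) f = blinfun_apply f x"
  unfolding evaluation_def
  by (rule fun_cong[OF bounded_linear_Blinfun_apply[OF blinfun.bounded_linear_left]])

lemma norm_evaluation_le: "norm (evaluation x) \<le> norm x"
proof (rule norm_blinfun_bound)
  show "norm (blinfun_apply (evaluation x) f) \<le> norm x * norm f" for f
    using norm_blinfun[of f x] by (simp add: evaluation_apply mult.commute)
qed simp

text \<open>One cluster point inherits every closed bound that holds on a tail of the sequence. It
  is applied both in the dual and, through evaluations, in the bidual.\<close>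

lemma weak_star_cluster_sequence:
  fixes u :: "nat \<Rightarrow> 'a::real_normed_vector dual"
  assumes "\<And>n. norm (u n) \<le> M"
  obtains g :: "'a dual" where "norm g \<le> M"
    and "\<And>x a c n. (\<And>m. n \<le> m \<Longrightarrow> \<bar>blinfun_apply (u m) x - a\<bar> \<le> c) \<Longrightarrow> \<bar>blinfun_apply g x - a\<bar> \<le> c"
proof -
  have nb: "filtermap u sequentially \<noteq> bot" by (simp add: filtermap_bot_iff)
  have ev: "eventually (\<lambda>f. norm f \<le> M) (filtermap u sequentially)"
    using assms by (simp add: eventually_filtermap)
  obtain g F where F: "F \<le> filtermap u sequentially" "F \<noteq> bot" "norm g \<le> M"
    "\<And>x. ((\<lambda>f. blinfun_apply f x) \<longlongrightarrow> blinfun_apply g x) F"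
    using weak_star_cluster_filter[OF nb ev] by metis
  show thesis
  proof (rule that[OF F(3)])
    fix x a c n assume *: "\<And>m. n \<le> m \<Longrightarrow> \<bar>blinfun_apply (u m) x - a\<bar> \<le> c"
    have "eventually (\<lambda>f. \<bar>blinfun_apply f x - a\<bar> \<le> c) (filtermap u sequentially)"
      unfolding eventually_filtermap eventually_sequentially using * by blast
    then have "eventually (\<lambda>f. \<bar>blinfun_apply f x - a\<bar> \<le> c) F" by (rule filter_leD[OF F(1)])
    moreover have "((\<lambda>f. \<bar>blinfun_apply f x - a\<bar>) \<longlongrightarrow> \<bar>blinfun_apply g x - a\<bar>) F"
      by (intro tendsto_intros F(4))
    ultimately show "\<bar>blinfun_apply g x - a\<bar> \<le> c" using tendsto_upperbound F(2) by blast
  qed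
qed

lemma uncountable_branches: "uncountable (UNIV :: (nat \<Rightarrow> bool) set)"
proof
  assume c: "countable (UNIV :: (nat \<Rightarrow> bool) set)"
  then obtain n where "from_nat_into UNIV n = (\<lambda>n. \<not> from_nat_into (UNIV :: (nat \<Rightarrow> bool) set) n n)"
    by (metis UNIV_I from_nat_into_surj)
  then show False by metis
qed

theorem almost_biorthogonal_of_separable:
  assumes sep: "\<exists>D::'a::real_normed_vector set. countable D \<and> closure D = UNIV"
    and nonsep: "\<nexists>D::'a dual set. countable D \<and> closure D = UNIV"
  shows "\<exists>P::'a dual set. uncountable P \<and> almost_biorthogonal P"
proof -
  obtain D where D: "countable D" "closure D = (UNIV :: 'a set)" using sep by blast
  obtain e M where eM: "0 < e" "0 < M" "\<not> coverable e (cball (0 :: 'a dual) M)"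
    using not_coverable_ball[OF nonsep] by blast
  obtain W :: "bool list \<Rightarrow> 'a dual set" and x where
    W: "\<And>t. W t \<noteq> {}" "\<And>t f. f \<in> W t \<Longrightarrow> norm f \<le> M" "\<And>t b. W (t @ [b]) \<subseteq> W t"
    and x: "\<And>t. norm (x t) \<le> 4 / e"
    "\<And>s t f. length s = length t \<Longrightarrow> t \<noteq> [] \<Longrightarrow> f \<in> W t \<Longrightarrow> \<bar>blinfun_apply f (x s) - of_bool (t = s)\<bar> \<le> 1/4"
    by (rule not_coverable_tree[OF D eM]) blast
  define br where "br = (\<lambda>(\<sigma> :: nat \<Rightarrow> bool) n. map \<sigma> [0..<n])"
  have br_len: "length (br \<sigma> n) = n" for \<sigma> n by (simp add: br_def)
  have br_mono: "W (br \<sigma> m) \<subseteq> W (br \<sigma> n)" if "n \<le> m" for \<sigma> n m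
    using that
  proof (induction m rule: dec_induct)
    case (step m)
    have "br \<sigma> (Suc m) = br \<sigma> m @ [\<sigma> m]" by (simp add: br_def)
    then show ?case using W(3) step.IH by (metis order_trans)
  qed simp
  define u where "u = (\<lambda>\<sigma> n. SOME f. f \<in> W (br \<sigma> n))"
  have u: "u \<sigma> n \<in> W (br \<sigma> n)" for \<sigma> n using W(1) by (simp add: u_def some_in_eq)
  have "\<exists>f :: 'a dual. norm f \<le> M \<and>
     (\<forall>s. s \<noteq> [] \<longrightarrow> \<bar>blinfun_apply f (x s) - of_bool (br \<sigma> (length s) = s)\<bar> \<le> 1/4)" for \<sigma>
  proof -
    have "norm (u \<sigma> n) \<le> M" for n using u W(2) by blast
    then obtain g :: "'a dual" where g: "norm g \<le> M"
      "\<And>x a c n. (\<And>m. n \<le> m \<Longrightarrow> \<bar>blinfun_apply (u \<sigma> m) x - a\<bar> \<le> c) \<Longrightarrow> \<bar>blinfun_apply g x - a\<bar> \<le> c"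
      using weak_star_cluster_sequence[of "u \<sigma>"] by metis
    have "\<bar>blinfun_apply g (x s) - of_bool (br \<sigma> (length s) = s)\<bar> \<le> 1/4" if s: "s \<noteq> []" for s
    proof (rule g(2)[of "length s"])
      fix m assume "length s \<le> m"
      then have "u \<sigma> m \<in> W (br \<sigma> (length s))" using u br_mono by blast
      moreover have "br \<sigma> (length s) \<noteq> []" using s br_len[of \<sigma> "length s"] by auto
      ultimately show "\<bar>blinfun_apply (u \<sigma> m) (x s) - of_bool (br \<sigma> (length s) = s)\<bar> \<le> 1/4"
        using br_len by (intro x(2)) auto
    qed
    then show ?thesis using g(1) by blast
  qed
  then obtain f :: "(nat \<Rightarrow> bool) \<Rightarrow> 'a dual" where f: "\<And>\<sigma>. norm (f \<sigma>) \<le> M"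
    "\<And>\<sigma> s. s \<noteq> [] \<Longrightarrow> \<bar>blinfun_apply (f \<sigma>) (x s) - of_bool (br \<sigma> (length s) = s)\<bar> \<le> 1/4" by metis
  \<comment> \<open>Here the roles change: \<open>\<Phi>\<close> is a cluster point in the bidual of
    the evaluations at the test points along the branch \<open>\<sigma>\<close>.\<close>
  have \<Phi>: "\<exists>\<Phi> :: 'a dual dual. norm \<Phi> \<le> 4 / e \<and> (\<forall>\<tau>. \<bar>blinfun_apply \<Phi> (f \<tau>) - of_bool (\<tau> = \<sigma>)\<bar> \<le> 1/4)" for \<sigma>
  proof -
    have "norm (evaluation (x (br \<sigma> n))) \<le> 4 / e" for n
      using norm_evaluation_le x(1) order_trans by blast
    then obtain \<Phi> :: "'a dual dual" where \<Phi>: "norm \<Phi> \<le> 4 / e"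
      "\<And>f a c n. (\<And>m. n \<le> m \<Longrightarrow> \<bar>blinfun_apply (evaluation (x (br \<sigma> m))) f - a\<bar> \<le> c) \<Longrightarrow> \<bar>blinfun_apply \<Phi> f - a\<bar> \<le> c"
      using weak_star_cluster_sequence[of "\<lambda>n. evaluation (x (br \<sigma> n))"] by metis
    have "\<bar>blinfun_apply \<Phi> (f \<tau>) - of_bool (\<tau> = \<sigma>)\<bar> \<le> 1/4" for \<tau>
    proof -
      \<comment> \<open>Distinct branches differ at some \<open>k\<close>, so their segments of
        length at least \<open>Suc k\<close> are distinct. For equal branches any \<open>k\<close>
        will do.\<close>
      obtain k where k: "\<tau> \<noteq> \<sigma> \<Longrightarrow> \<tau> k \<noteq> \<sigma> k" by blast
      show ?thesis
      proof (rule \<Phi>(2)[of "Suc k"])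
        fix m assume m: "Suc k \<le> m"
        have "br \<tau> m = br \<sigma> m \<longleftrightarrow> \<tau> = \<sigma>" using k m by (force simp: br_def)
        moreover have "br \<sigma> m \<noteq> []" using m br_len[of \<sigma> m] by auto
        ultimately show "\<bar>blinfun_apply (evaluation (x (br \<sigma> m))) (f \<tau>) - of_bool (\<tau> = \<sigma>)\<bar> \<le> 1/4"
          using f(2)[of "br \<sigma> m" \<tau>] by (simp add: evaluation_apply br_len)
      qed
    qed
    then show ?thesis using \<Phi>(1) by blast
  qed
  have "inj f"
  proof (rule injI, rule ccontr)
    fix \<sigma> \<tau> assume *: "f \<sigma> = f \<tau>" "\<sigma> \<noteq> \<tau>"
    obtain \<Phi> :: "'a dual dual" where "\<And>\<rho>. \<bar>\<Phi> (f \<rho>) - of_bool (\<rho> = \<sigma>)\<bar> \<le> 1/4" using \<Phi> by blast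
    from this[of \<sigma>] this[of \<tau>] * show False by (simp add: abs_le_iff)
  qed
  then have "uncountable (range f)" using uncountable_branches countable_image_inj_on by blast
  moreover have "almost_biorthogonal (range f)"
  \<comment> \<open>An error of 1/4 leaves at least 3/4 on the diagonal and at most 1/4 off it,
    within the permitted 3/8.\<close>
  proof (rule almost_biorthogonalI[where a = "3/4" and K = "4 / e"])
    show "bounded (range f)" using f(1) by (auto simp: bounded_iff)
    fix p assume "p \<in> range f"
    then obtain \<sigma> where \<sigma>: "p = f \<sigma>" by blast
    obtain \<Phi> :: "'a dual dual" where *: "norm \<Phi> \<le> 4 / e" "\<And>\<tau>. \<bar>\<Phi> (f \<tau>) - of_bool (\<tau> = \<sigma>)\<bar> \<le> 1/4" using \<Phi> by blast
    have "\<bar>\<Phi> q\<bar> \<le> 3/4/2" if q: "q \<in> range f - {p}" for q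
    proof -
      obtain \<tau> where "q = f \<tau>" "\<tau> \<noteq> \<sigma>" using q \<sigma> by auto
      then show ?thesis using *(2)[of \<tau>] by simp
    qed
    moreover have "\<bar>\<Phi> p - 1\<bar> \<le> 1/4" using *(2)[of \<sigma>] \<sigma> by simp
    then have "3/4 \<le> \<Phi> p" by linarith
    ultimately have "(\<forall>q\<in>range f - {p}. \<bar>\<Phi> q\<bar> \<le> 3/4/2) \<and> 3/4 \<le> \<Phi> p" by blast
    then show "\<exists>\<Phi>::'a dual dual. norm \<Phi> \<le> 4 / e \<and> 3/4 \<le> blinfun_apply \<Phi> p \<and>
      (\<forall>q\<in>range f - {p}. \<bar>blinfun_apply \<Phi> q\<bar> \<le> 3/4/2)" using *(1) by blast
  qed simp
  ultimately show ?thesis by blast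
qed

section \<open>Separability of the dual and the resulting renorming\<close>

theorem mainTheorem1:
  assumes nonzero: "\<exists>x::'a::banach. x \<noteq> 0"
    and conditions:
      "(\<forall>B :: 'a dual dual set. dual_ball B \<longrightarrow> weak_star_separable B) \<or>
       (\<forall>C :: 'a dual dual set. closedin weak_star C \<and> convex C \<longrightarrow> weak_star_separable C) \<or>
       (\<forall>C :: 'a dual set. closed C \<and> convex C \<longrightarrow> constructible C)"
  shows "\<exists>p :: 'a \<Rightarrow> real. equivalent_norm p \<and>
           (\<forall>x. x \<noteq> 0 \<longrightarrow> frechet_differentiable_norm_at p x)"
proof -
  have "\<exists>D::'a dual set. countable D \<and> closure D = UNIV"
  proof (rule ccontr)
    assume nonsep: "\<not> ?thesis"
    have "\<exists>P::'a dual set. uncountable P \<and> almost_biorthogonal P"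
    proof (cases "\<exists>D::'a set. countable D \<and> closure D = UNIV")
      case True
      then show ?thesis using nonsep by (rule almost_biorthogonal_of_separable)
    next
      case False
      then show ?thesis by (rule almost_biorthogonal_of_nonseparable)
    qed
    then obtain P :: "'a dual set" where P: "almost_biorthogonal P" "uncountable P" by blast
    \<comment> \<open>The first conclusion refutes both separability conditions, the second the
      constructibility condition.\<close>
    from uncountable_almost_biorthogonal[OF this] conditions show False by blast
  qed
  then obtain D :: "'a dual set" where D: "countable D" "closure D = UNIV" by blast
  \<comment> \<open>Nonemptiness lets \<open>from_nat_into D\<close> enumerate exactly
    \<open>D\<close>, giving the dense sequence for the smoothing series.\<close>
  then have "D \<noteq> {}" by auto
  then have "closure (range (from_nat_into D)) = UNIV"
    using D by (simp add: range_from_nat_into)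
  then show ?thesis by (rule frechet_norm_of_separable_dual)
qed

end
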